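(* Let $X$ be an $n$-dimensional complex manifold. For any $C^\infty$ function $\eta$ on $X$ such that $\eta>0$ or $\eta<0$ and any $k\in\{0,\dots,2n\}$, the linear map $$\theta_\eta:H^k_{DR}(X,\mathbb C)\longrightarrow H^k_{D_\eta}(X,\mathbb C),\qquad\{u\}_{DR}\longmapsto\{\theta_\eta u\}_{D_\eta},$$ is well defined and an isomorphism.
   Context: $\eta$ is real-valued and $\eta>0$ (resp. $\eta<0$) means at every point. $C^\infty_k(X,\mathbb C)$ is the space of smooth complex-valued $k$-forms. $\theta_\eta$ is the automorphism of forms defined on $(p,q)$-forms by $\theta_\eta(u)=\eta^p u$ and extended by linearity to $k$-forms: $\theta_\eta(\sum_{p+q=k}u^{p,q})=\sum_{p+q=k}\eta^p u^{p,q}$. The operator $D_\eta:C^\infty_k(X,\mathbb C)\to C^\infty_{k+1}(X,\mathbb C)$ is $D_\eta=\theta_\eta d\theta_\eta^{-1}$; it satisfies $D_\eta^2=0$. $H^k_{DR}(X,\mathbb C)$ is the De Rham cohomology (class $\{u\}_{DR}$) and $H^k_{D_\eta}(X,\mathbb C):=\ker(D_\eta:C^\infty_k\to C^\infty_{k+1})/\mathrm{Im}(D_\eta:C^\infty_{k-1}\to C^\infty_k)$ (class $\{u\}_{D_\eta}$). *)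

theory Defs
  imports "HOL-Analysis.Analysis" "HOL-Library.Function_Algebras"
begin

text \<open>\<open>C\<^sup>m\<close> on an open subset of a finite-dimensional space: directional derivatives in fixed
  directions suffice.\<close>

primrec Ck_on :: "nat \<Rightarrow> 'a::real_normed_vector set \<Rightarrow> ('a \<Rightarrow> 'b::real_normed_vector) \<Rightarrow> bool" where
  "Ck_on 0 S f \<longleftrightarrow> continuous_on S f"
| "Ck_on (Suc m) S f \<longleftrightarrow>
     (\<forall>x\<in>S. f differentiable (at x)) \<and>
     (\<forall>w. Ck_on m S (\<lambda>x. frechet_derivative f (at x) w))"

definition smooth_on :: "'a::real_normed_vector set \<Rightarrow> ('a \<Rightarrow> 'b::real_normed_vector) \<Rightarrow> bool" where
  "smooth_on S f \<longleftrightarrow> (\<forall>m. Ck_on m S f)"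

definition holomorphic_map_on :: "(complex^'n \<Rightarrow> complex^'m) \<Rightarrow> (complex^'n) set \<Rightarrow> bool" where
  "holomorphic_map_on f S \<longleftrightarrow>
     (\<forall>z\<in>S. \<exists>L. (f has_derivative L) (at z) \<and> (\<forall>c w. L (c *s w) = c *s L w))"

text \<open>A chart is a pair of its domain and its coordinate map; the values of the coordinate map
  off the domain are irrelevant. The complex dimension of the manifold is \<open>CARD('n)\<close>.
  Atlases are not required to be maximal.\<close>

type_synonym ('x, 'n) chart = "'x set \<times> ('x \<Rightarrow> complex^'n)"

definition chart_image :: "('x, 'n) chart \<Rightarrow> (complex^'n) set" where
  "chart_image a = snd a ` fst a"

definition chart_inv :: "('x, 'n) chart \<Rightarrow> complex^'n \<Rightarrow> 'x" where
  "chart_inv a = inv_into (fst a) (snd a)"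

definition transition :: "('x, 'n) chart \<Rightarrow> ('x, 'n) chart \<Rightarrow> complex^'n \<Rightarrow> complex^'n" where
  "transition a b = snd b \<circ> chart_inv a"

definition complex_manifold :: "'x topology \<Rightarrow> ('x, 'n::finite) chart set \<Rightarrow> bool" where
  "complex_manifold X A \<longleftrightarrow>
     Hausdorff_space X \<and> second_countable X \<and>
     topspace X = (\<Union>a\<in>A. fst a) \<and>
     (\<forall>a\<in>A. openin X (fst a) \<and> open (chart_image a) \<and>
        homeomorphic_map (subtopology X (fst a)) (top_of_set (chart_image a)) (snd a)) \<and>
     (\<forall>a\<in>A. \<forall>b\<in>A. holomorphic_map_on (transition a b) (snd a ` (fst a \<inter> fst b)))"

definition smooth_function :: "('x, 'n::finite) chart set \<Rightarrow> ('x \<Rightarrow> real) \<Rightarrow> bool" where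
  "smooth_function A \<eta> \<longleftrightarrow> (\<forall>a\<in>A. smooth_on (chart_image a) (\<eta> \<circ> chart_inv a))"

text \<open>A \<open>k\<close>-covector is an alternating \<open>\<real>\<close>-multilinear map of \<open>k\<close> vectors. The vectors are given as a
  sequence of which only the first \<open>k\<close> entries matter.\<close>

type_synonym 'n covector = "(nat \<Rightarrow> complex^'n) \<Rightarrow> complex"

definition covectors :: "nat \<Rightarrow> 'n::finite covector set" where
  "covectors k = {\<omega>.
     (\<forall>v w. (\<forall>i<k. v i = w i) \<longrightarrow> \<omega> v = \<omega> w) \<and>
     (\<forall>v. \<forall>i<k. linear (\<lambda>w. \<omega> (v(i := w)))) \<and>
     (\<forall>v. \<forall>i<k. \<forall>j<k. i \<noteq> j \<and> v i = v j \<longrightarrow> \<omega> v = 0)}"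

text \<open>The covector \<open>dz\<^bsub>I 0\<^esub> \<and> \<dots> \<and> dz\<^bsub>I (p-1)\<^esub> \<and> dz*\<^bsub>J 0\<^esub> \<and> \<dots> \<and> dz*\<^bsub>J (q-1)\<^esub>\<close>, as a determinant
  (\<open>z*\<close> is the conjugate coordinate).\<close>

definition dz_dzbar :: "nat \<Rightarrow> nat \<Rightarrow> (nat \<Rightarrow> 'n::finite) \<Rightarrow> (nat \<Rightarrow> 'n) \<Rightarrow> 'n covector" where
  "dz_dzbar p q I J v =
     (\<Sum>\<sigma> | \<sigma> permutes {..<p+q}. of_int (sign \<sigma>) *
        ((\<Prod>a<p. v (\<sigma> a) $ I a) * (\<Prod>b<q. cnj (v (\<sigma> (p + b)) $ J b))))"

text \<open>The linear span of these. All multi-indices are allowed, since no order on \<open>'n\<close> is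
  available; the redundant ones do not change the span.\<close>

definition pq_covectors :: "nat \<Rightarrow> nat \<Rightarrow> 'n::finite covector set" where
  "pq_covectors p q = {\<omega>. \<exists>c. \<omega> =
     (\<lambda>v. \<Sum>I\<in>{..<p} \<rightarrow>\<^sub>E UNIV. \<Sum>J\<in>{..<q} \<rightarrow>\<^sub>E UNIV. c I J * dz_dzbar p q I J v)}"

text \<open>The component of type \<open>(p, k - p)\<close> of a \<open>k\<close>-covector: the \<open>p\<close>-th member of the unique
  decomposition of \<open>\<omega>\<close> into components of pure type. Its values at \<open>p > k\<close> are fixed only to make
  the description definite.\<close>

definition pq_component :: "nat \<Rightarrow> 'n::finite covector \<Rightarrow> nat \<Rightarrow> 'n covector" where
  "pq_component k \<omega> =
     (THE f. (\<forall>p\<le>k. f p \<in> pq_covectors p (k - p)) \<and> (\<forall>p>k. f p = 0) \<and> \<omega> = (\<Sum>p\<le>k. f p))"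

text \<open>A form on the manifold is the family of its expressions in the charts of the atlas, subject to
  the transformation law under changes of charts. Expressions are \<open>0\<close> outside the
  images of the charts of the atlas, so that equal forms are equal as functions.\<close>

type_synonym ('x, 'n) form = "('x, 'n) chart \<Rightarrow> complex^'n \<Rightarrow> 'n covector"

definition form_scale :: "complex \<Rightarrow> ('x, 'n) form \<Rightarrow> ('x, 'n) form" where
  "form_scale c u = (\<lambda>a y v. c * u a y v)"

definition smooth_forms :: "('x, 'n::finite) chart set \<Rightarrow> nat \<Rightarrow> ('x, 'n) form set" where
  "smooth_forms A k = {u.
     (\<forall>a\<in>A. \<forall>y\<in>chart_image a. u a y \<in> covectors k) \<and>
     (\<forall>a\<in>A. \<forall>v. smooth_on (chart_image a) (\<lambda>y. u a y v)) \<and>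
     (\<forall>a\<in>A. \<forall>b\<in>A. \<forall>y\<in>snd a ` (fst a \<inter> fst b). \<forall>v.
        u a y v = u b (transition a b y) (\<lambda>i. frechet_derivative (transition a b) (at y) (v i))) \<and>
     (\<forall>a y. a \<notin> A \<or> y \<notin> chart_image a \<longrightarrow> u a y = 0)}"

text \<open>The exterior derivative of \<open>k\<close>-forms, normalised compatibly with the determinant convention
  for the wedge product above.\<close>

definition ext_deriv :: "('x, 'n::finite) chart set \<Rightarrow> nat \<Rightarrow> ('x, 'n) form \<Rightarrow> ('x, 'n) form" where
  "ext_deriv A k u = (\<lambda>a y v.
     if a \<in> A \<and> y \<in> chart_image a
     then \<Sum>i\<le>k. (-1) ^ i *
       frechet_derivative (\<lambda>z. u a z (\<lambda>j. if j < i then v j else v (Suc j))) (at y) (v i)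
     else 0)"

definition theta ::
    "('x \<Rightarrow> real) \<Rightarrow> nat \<Rightarrow> ('x, 'n::finite) form \<Rightarrow> ('x, 'n) form" where
  "theta \<eta> k u = (\<lambda>a y v.
     \<Sum>p\<le>k. of_real (\<eta> (chart_inv a y) ^ p) * pq_component k (u a y) p v)"

definition D_eta ::
    "('x, 'n::finite) chart set \<Rightarrow> ('x \<Rightarrow> real) \<Rightarrow> nat \<Rightarrow> ('x, 'n) form \<Rightarrow> ('x, 'n) form" where
  "D_eta A \<eta> k = theta \<eta> (Suc k) \<circ> ext_deriv A k \<circ> inv_into (smooth_forms A k) (theta \<eta> k)"

text \<open>\<open>D k\<close> acts from \<open>k\<close>-forms to \<open>(k + 1)\<close>-forms.\<close>

type_synonym ('x, 'n) operator = "nat \<Rightarrow> ('x, 'n) form \<Rightarrow> ('x, 'n) form"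

definition cocycles ::
    "('x, 'n::finite) chart set \<Rightarrow> ('x, 'n) operator \<Rightarrow> nat \<Rightarrow> ('x, 'n) form set" where
  "cocycles A D k = {u \<in> smooth_forms A k. D k u = 0}"

definition coboundaries ::
    "('x, 'n::finite) chart set \<Rightarrow> ('x, 'n) operator \<Rightarrow> nat \<Rightarrow> ('x, 'n) form set" where
  "coboundaries A D k = (case k of 0 \<Rightarrow> {0} | Suc j \<Rightarrow> D j ` smooth_forms A j)"

definition coh_rel ::
    "('x, 'n::finite) chart set \<Rightarrow> ('x, 'n) operator \<Rightarrow> nat \<Rightarrow> (('x, 'n) form \<times> ('x, 'n) form) set" where
  "coh_rel A D k = {(u, v). u \<in> cocycles A D k \<and> v \<in> cocycles A D k \<and> u - v \<in> coboundaries A D k}"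

definition cohomology ::
    "('x, 'n::finite) chart set \<Rightarrow> ('x, 'n) operator \<Rightarrow> nat \<Rightarrow> ('x, 'n) form set set" where
  "cohomology A D k = cocycles A D k // coh_rel A D k"

definition coh_class ::
    "('x, 'n::finite) chart set \<Rightarrow> ('x, 'n) operator \<Rightarrow> nat \<Rightarrow> ('x, 'n) form \<Rightarrow> ('x, 'n) form set" where
  "coh_class A D k u = coh_rel A D k `` {u}"

definition coh_add ::
    "('x, 'n::finite) chart set \<Rightarrow> ('x, 'n) operator \<Rightarrow> nat \<Rightarrow>
     ('x, 'n) form set \<Rightarrow> ('x, 'n) form set \<Rightarrow> ('x, 'n) form set" where
  "coh_add A D k \<alpha> \<beta> = (\<Union>u\<in>\<alpha>. \<Union>v\<in>\<beta>. coh_class A D k (u + v))"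

definition coh_scale ::
    "('x, 'n::finite) chart set \<Rightarrow> ('x, 'n) operator \<Rightarrow> nat \<Rightarrow>
     complex \<Rightarrow> ('x, 'n) form set \<Rightarrow> ('x, 'n) form set" where
  "coh_scale A D k c \<alpha> = (\<Union>u\<in>\<alpha>. coh_class A D k (form_scale c u))"

definition coh_linear ::
    "('x, 'n::finite) chart set \<Rightarrow> ('x, 'n) operator \<Rightarrow> ('x, 'n) operator \<Rightarrow> nat \<Rightarrow>
     (('x, 'n) form set \<Rightarrow> ('x, 'n) form set) \<Rightarrow> bool" where
  "coh_linear A D E k T \<longleftrightarrow>
     (\<forall>\<alpha>\<in>cohomology A D k. \<forall>\<beta>\<in>cohomology A D k.
        T (coh_add A D k \<alpha> \<beta>) = coh_add A E k (T \<alpha>) (T \<beta>)) \<and>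
     (\<forall>c. \<forall>\<alpha>\<in>cohomology A D k. T (coh_scale A D k c \<alpha>) = coh_scale A E k c (T \<alpha>))"

end

theory Submission
  imports Defs "HOL-Library.Real_Mod"
begin

text \<open>A covector of type \<open>(p, k - p)\<close> is multiplied by \<open>c\<^sup>p (c*)\<^bsup>k - p\<^esup>\<close> when all its arguments are
  multiplied by \<open>c\<close>, so averaging over suitable roots of unity projects onto the components of pure
  type. Together with the existence of the type decomposition, this expresses the components of a
  form as constant combinations of \<open>u (c v)\<close>; hence they are smooth, and they are compatible with
  changes of charts because these have complex-linear derivatives. So \<open>\<theta>\<^sub>\<eta>\<close> is an automorphism of the
  smooth forms with inverse \<open>\<theta>\<close> at \<open>1/\<eta>\<close>. As \<open>D\<^sub>\<eta>\<close> is the conjugate of \<open>d\<close> by \<open>\<theta>\<^sub>\<eta>\<close>, it only remains to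
  transport cocycles and coboundaries. Here \<open>\<theta>\<^sub>\<eta>\<close> is applied to forms \<open>d u\<close>, and its injectivity there
  needs only that \<open>d u\<close> is pointwise an alternating covector; neither \<open>d\<^sup>2 = 0\<close> nor the invariance of
  \<open>d\<close> under changes of charts enters.\<close>

section \<open>Smoothness of composite functions\<close>

text \<open>\<open>frechet_derivative\<close> is a choice from the predicate
  \<open>has_derivative\<close>. Both functions have the same derivatives at \<open>x\<close>, so
  the choices coincide even if there are none.\<close>

lemma frechet_derivative_cong_open:
  assumes "open S" "x \<in> S" "\<And>y. y \<in> S \<Longrightarrow> f y = g y"
  shows "frechet_derivative f (at x) = frechet_derivative g (at x)"
proof -
  have "(f has_derivative f') (at x) \<longleftrightarrow> (g has_derivative f') (at x)" for f'
    using assms by (metis has_derivative_transform_within_open)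
  then show ?thesis
    by (simp add: frechet_derivative_def)
qed

text \<open>Differentiation rules give formulas for \<open>frechet_derivative\<close> only at points
  of \<open>S\<close>; this allows them to be substituted inside the recursion of
  \<open>Ck_on\<close>.\<close>

lemma Ck_on_cong:
  assumes "open S" "\<And>x. x \<in> S \<Longrightarrow> f x = g x" "Ck_on m S f"
  shows "Ck_on m S g"
  using assms(2,3)
proof (induction m arbitrary: f g)
  case 0
  then show ?case
    by (simp cong: continuous_on_cong)
next
  case (Suc m)
  have "g differentiable (at x)" if "x \<in> S" for x
    using Suc.prems that assms(1) unfolding Ck_on.simps differentiable_def
    by (metis has_derivative_transform_within_open)
  moreover have "Ck_on m S (\<lambda>x. frechet_derivative g (at x) w)" for w
  proof (rule Suc.IH)
    show "Ck_on m S (\<lambda>x. frechet_derivative f (at x) w)"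
      using Suc.prems by simp
    show "frechet_derivative f (at x) w = frechet_derivative g (at x) w" if "x \<in> S" for x
      using frechet_derivative_cong_open[OF assms(1) that Suc.prems(1)] by simp
  qed
  ultimately show ?case
    by simp
qed

lemma Ck_on_SucD:
  "Ck_on (Suc m) S f \<Longrightarrow> Ck_on m S f"
proof (induction m arbitrary: f)
  case 0
  then show ?case
    by (auto intro!: continuous_at_imp_continuous_on differentiable_imp_continuous_within)
next
  case (Suc m)
  then show ?case
    by (metis Ck_on.simps(2))
qed

lemma Ck_on_const: "Ck_on m S (\<lambda>x. c)"
  by (induction m arbitrary: c) (simp_all add: frechet_derivative_const)

lemma Ck_on_add:
  assumes "open S" "Ck_on m S f" "Ck_on m S g"
  shows "Ck_on m S (\<lambda>x. f x + g x)"
  using assms(2,3)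
proof (induction m arbitrary: f g)
  case 0
  then show ?case
    by (simp add: continuous_on_add)
next
  case (Suc m)
  have D: "((\<lambda>x. f x + g x) has_derivative
      (\<lambda>w. frechet_derivative f (at x) w + frechet_derivative g (at x) w)) (at x)" if "x \<in> S" for x
    using Suc.prems that
    by (auto intro!: has_derivative_add simp: frechet_derivative_works[symmetric])
  have "Ck_on m S (\<lambda>x. frechet_derivative (\<lambda>x. f x + g x) (at x) w)" for w
  proof (rule Ck_on_cong[OF assms(1)])
    show "Ck_on m S (\<lambda>x. frechet_derivative f (at x) w + frechet_derivative g (at x) w)"
      using Suc by simp
    show "frechet_derivative f (at x) w + frechet_derivative g (at x) w =
        frechet_derivative (\<lambda>x. f x + g x) (at x) w" if "x \<in> S" for x
      using frechet_derivative_at[OF D[OF that]] by metis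
  qed
  then show ?case
    using D by (auto intro: differentiableI)
qed

lemma Ck_on_bounded_linear:
  assumes "open S" "bounded_linear L" "Ck_on m S f"
  shows "Ck_on m S (\<lambda>x. L (f x))"
  using assms(3)
proof (induction m arbitrary: f)
  case 0
  then show ?case
    using bounded_linear.continuous_on[OF assms(2)] by simp
next
  case (Suc m)
  have D: "((\<lambda>x. L (f x)) has_derivative (\<lambda>w. L (frechet_derivative f (at x) w))) (at x)"
    if "x \<in> S" for x
    using Suc.prems that
    by (auto intro!: bounded_linear.has_derivative[OF assms(2)] simp: frechet_derivative_works[symmetric])
  have "Ck_on m S (\<lambda>x. frechet_derivative (\<lambda>x. L (f x)) (at x) w)" for w
  proof (rule Ck_on_cong[OF assms(1)])
    show "Ck_on m S (\<lambda>x. L (frechet_derivative f (at x) w))"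
      using Suc by simp
    show "L (frechet_derivative f (at x) w) = frechet_derivative (\<lambda>x. L (f x)) (at x) w"
      if "x \<in> S" for x
      using frechet_derivative_at[OF D[OF that]] by metis
  qed
  then show ?case
    using D by (auto intro: differentiableI)
qed

lemma Ck_on_mult:
  fixes f g :: "'a::real_normed_vector \<Rightarrow> 'b::real_normed_algebra"
  assumes "open S" "Ck_on m S f" "Ck_on m S g"
  shows "Ck_on m S (\<lambda>x. f x * g x)"
  using assms(2,3)
proof (induction m arbitrary: f g)
  case 0
  then show ?case
    by (simp add: continuous_on_mult)
next
  case (Suc m)
  have D: "((\<lambda>x. f x * g x) has_derivative (\<lambda>w. f x * frechet_derivative g (at x) w +
      frechet_derivative f (at x) w * g x)) (at x)" if "x \<in> S" for x
    using Suc.prems that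
    by (auto intro!: has_derivative_mult simp: frechet_derivative_works[symmetric])
  have "Ck_on m S (\<lambda>x. frechet_derivative (\<lambda>x. f x * g x) (at x) w)" for w
  proof (rule Ck_on_cong[OF assms(1)])
    show "Ck_on m S (\<lambda>x. f x * frechet_derivative g (at x) w + frechet_derivative f (at x) w * g x)"
      \<comment> \<open>The product rule mixes derivatives with \<open>f\<close> and
        \<open>g\<close> themselves, whose order is lowered by \<open>Ck_on_SucD\<close> to fit the
        induction hypothesis.\<close>
      using Suc.prems by (intro Ck_on_add[OF assms(1)] Suc.IH) (simp_all add: Ck_on_SucD)
    show "f x * frechet_derivative g (at x) w + frechet_derivative f (at x) w * g x =
        frechet_derivative (\<lambda>x. f x * g x) (at x) w" if "x \<in> S" for x
      using frechet_derivative_at[OF D[OF that]] by metis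
  qed
  then show ?case
    using D by (auto intro: differentiableI)
qed

text \<open>The derivative of \<open>1 / f\<close> is a product of \<open>1 / f\<close>,
  \<open>f'\<close> and \<open>1 / f\<close>, so the induction can keep \<open>f\<close> fixed and
  use the lower order of \<open>1 / f\<close> itself.\<close>

lemma Ck_on_inverse:
  fixes f :: "'a::real_normed_vector \<Rightarrow> 'b::real_normed_field"
  assumes "open S" "Ck_on m S f" "\<And>x. x \<in> S \<Longrightarrow> f x \<noteq> 0"
  shows "Ck_on m S (\<lambda>x. inverse (f x))"
  using assms(2)
proof (induction m)
  case 0
  then show ?case
    using assms(3) by (simp add: continuous_on_inverse)
next
  case (Suc m)
  have D: "((\<lambda>x. inverse (f x)) has_derivative
      (\<lambda>w. - (inverse (f x) * frechet_derivative f (at x) w * inverse (f x)))) (at x)"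
    if "x \<in> S" for x
    using Suc.prems that assms(3)
    by (auto intro!: has_derivative_inverse simp: frechet_derivative_works[symmetric])
  have IH: "Ck_on m S (\<lambda>x. inverse (f x))"
    using Suc Ck_on_SucD by blast
  have "Ck_on m S (\<lambda>x. frechet_derivative (\<lambda>x. inverse (f x)) (at x) w)" for w
  proof (rule Ck_on_cong[OF assms(1)])
    show "Ck_on m S (\<lambda>x. - (inverse (f x) * frechet_derivative f (at x) w * inverse (f x)))"
      using Suc.prems
      by (intro Ck_on_bounded_linear[OF assms(1) bounded_linear_minus[OF bounded_linear_ident]]
          Ck_on_mult[OF assms(1)] IH) simp
    show "- (inverse (f x) * frechet_derivative f (at x) w * inverse (f x)) =
        frechet_derivative (\<lambda>x. inverse (f x)) (at x) w" if "x \<in> S" for x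
      using frechet_derivative_at[OF D[OF that]] by metis
  qed
  then show ?case
    using D by (auto intro: differentiableI)
qed

lemma smooth_on_const: "smooth_on S (\<lambda>x. c)"
  by (simp add: smooth_on_def Ck_on_const)

lemma smooth_on_mult:
  fixes f g :: "'a::real_normed_vector \<Rightarrow> 'b::real_normed_algebra"
  shows "open S \<Longrightarrow> smooth_on S f \<Longrightarrow> smooth_on S g \<Longrightarrow> smooth_on S (\<lambda>x. f x * g x)"
  by (simp add: smooth_on_def Ck_on_mult)

lemma smooth_on_power:
  fixes f :: "'a::real_normed_vector \<Rightarrow> 'b::real_normed_algebra_1"
  shows "open S \<Longrightarrow> smooth_on S f \<Longrightarrow> smooth_on S (\<lambda>x. f x ^ n)"
  by (induction n) (simp_all add: smooth_on_const smooth_on_mult)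

lemma smooth_on_sum:
  "open S \<Longrightarrow> (\<And>i. i \<in> I \<Longrightarrow> smooth_on S (f i)) \<Longrightarrow> smooth_on S (\<lambda>x. \<Sum>i\<in>I. f i x)"
  by (induction I rule: infinite_finite_induct)
     (simp_all add: smooth_on_def Ck_on_const Ck_on_add)

lemma smooth_on_of_real:
  "open S \<Longrightarrow> smooth_on S f \<Longrightarrow>
     smooth_on S (\<lambda>x. of_real (f x) :: 'b::{real_normed_algebra_1})"
  by (simp add: smooth_on_def Ck_on_bounded_linear[OF _ bounded_linear_of_real])

lemma smooth_on_inverse:
  fixes f :: "'a::real_normed_vector \<Rightarrow> 'b::real_normed_field"
  shows "open S \<Longrightarrow> smooth_on S f \<Longrightarrow> (\<And>x. x \<in> S \<Longrightarrow> f x \<noteq> 0) \<Longrightarrow> smooth_on S (\<lambda>x. inverse (f x))"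
  by (simp add: smooth_on_def Ck_on_inverse)

lemma smooth_on_imp_differentiable: "smooth_on S f \<Longrightarrow> x \<in> S \<Longrightarrow> f differentiable (at x)"
  using Ck_on.simps(2) smooth_on_def by blast

section \<open>Covectors and multilinear expansion\<close>

lemma sum_fun_apply: "(\<Sum>i\<in>I. f i) x = (\<Sum>i\<in>I. f i x)"
  by (induction I rule: infinite_finite_induct) simp_all

lemma covectors_cong: "\<omega> \<in> covectors k \<Longrightarrow> (\<And>i. i < k \<Longrightarrow> v i = w i) \<Longrightarrow> \<omega> v = \<omega> w"
  by (auto simp: covectors_def)

lemma covectors_linear: "\<omega> \<in> covectors k \<Longrightarrow> i < k \<Longrightarrow> linear (\<lambda>w. \<omega> (v(i := w)))"
  by (auto simp: covectors_def)

lemma covectors_alternating: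
  "\<omega> \<in> covectors k \<Longrightarrow> i < k \<Longrightarrow> j < k \<Longrightarrow> i \<noteq> j \<Longrightarrow> v i = v j \<Longrightarrow> \<omega> v = 0"
  unfolding covectors_def by blast

lemma covectorsI:
  assumes "\<And>v w. (\<And>i. i < k \<Longrightarrow> v i = w i) \<Longrightarrow> \<omega> v = \<omega> w"
    and "\<And>v i. i < k \<Longrightarrow> linear (\<lambda>w. \<omega> (v(i := w)))"
    and "\<And>v i j. i < j \<Longrightarrow> j < k \<Longrightarrow> v i = v j \<Longrightarrow> \<omega> v = 0"
  shows "\<omega> \<in> covectors k"
proof -
  have "\<omega> v = 0" if "i < k" "j < k" "i \<noteq> j" "v i = v j" for v i j
    using assms(3)[of i j v] assms(3)[of j i v] that by (cases "i < j") auto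
  then show ?thesis
    using assms(1,2) unfolding covectors_def by blast
qed

lemma zero_in_covectors: "0 \<in> covectors k"
  by (auto simp: covectors_def linear_iff)

text \<open>Polarisation: with \<open>v i + v j\<close> in both places the value is zero, and its
  bilinear expansion leaves only the two mixed terms, which therefore cancel.\<close>

lemma covectors_transpose:
  assumes \<omega>: "\<omega> \<in> covectors k" and ij: "i < k" "j < k" "i \<noteq> j"
  shows "\<omega> (v \<circ> Transposition.transpose i j) = - \<omega> v"
proof -
  define F where "F x y = \<omega> (v(i := x, j := y))" for x y
  have alt: "F x x = 0" for x
    unfolding F_def using ij by (intro covectors_alternating[OF \<omega> ij]) simp
  have r: "F x (y + z) = F x y + F x z" for x y z
    unfolding F_def using linear_add[OF covectors_linear[OF \<omega> ij(2)]] by blast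
  have l: "F (x + y) z = F x z + F y z" for x y z
    using linear_add[OF covectors_linear[OF \<omega> ij(1)], of "v(j := z)" x y] ij(3)
    by (simp add: F_def fun_upd_twist)
  have "F (v i + v j) (v i + v j) =
      F (v i) (v i) + F (v j) (v i) + (F (v i) (v j) + F (v j) (v j))"
    by (simp only: l r)
  then have "F (v j) (v i) = - F (v i) (v j)"
    by (simp add: alt eq_neg_iff_add_eq_0)
  moreover have "v \<circ> Transposition.transpose i j = v(i := v j, j := v i)"
    using ij(3) by (auto simp: fun_eq_iff Transposition.transpose_def)
  ultimately show ?thesis
    by (simp add: F_def)
qed

text \<open>Each transposition contributes a sign. The reversed induction splits it off on the
  right, where \<open>covectors_transpose\<close> applies to \<open>v \<circ> p\<close>.\<close>

lemma covectors_permute: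
  assumes "\<omega> \<in> covectors k" "\<sigma> permutes {..<k}"
  shows "\<omega> (v \<circ> \<sigma>) = of_int (sign \<sigma>) * \<omega> v"
proof -
  have "finite {..<k}"
    by simp
  then show ?thesis
    using assms(2)
  proof (induction rule: permutes_rev_induct)
    case id
    then show ?case
      by simp
  next
    case (swap a b p)
    have "permutation p"
      using swap permutes_imp_permutation by blast
    then have s: "sign (p \<circ> Transposition.transpose a b) = - sign p"
      using swap by (simp add: sign_compose permutation_swap_id sign_swap_id)
    have "\<omega> (v \<circ> p \<circ> Transposition.transpose a b) = - \<omega> (v \<circ> p)"
      using swap by (intro covectors_transpose[OF assms(1)]) simp_all
    then show ?case
      by (simp only: s swap.IH comp_assoc of_int_minus mult_minus_left)
  qed
qed

text \<open>The coordinate functionals \<open>dz\<close> (flag \<open>True\<close>) and their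
  conjugates (flag \<open>False\<close>), which together form a complex basis of the real-linear
  maps to \<open>complex\<close>.\<close>

definition elementary_functional :: "'n \<times> bool \<Rightarrow> complex^'n \<Rightarrow> complex" where
  "elementary_functional t w = (if snd t then w $ fst t else cnj (w $ fst t))"

text \<open>The coefficients are the Wirtinger derivatives of \<open>L\<close>, read off from its
  values on the real basis \<open>axis m 1\<close>, \<open>axis m \<i>\<close>.\<close>

lemma real_linear_functional_expansion:
  fixes L :: "complex^'n::finite \<Rightarrow> complex"
  assumes "linear L"
  shows "L w = (\<Sum>m\<in>UNIV.
      (L (axis m 1) - \<i> * L (axis m \<i>)) / 2 * elementary_functional (m, True) w +
      (L (axis m 1) + \<i> * L (axis m \<i>)) / 2 * elementary_functional (m, False) w)"
proof -
  have "w = (\<Sum>m\<in>UNIV. Re (w $ m) *\<^sub>R axis m 1 + Im (w $ m) *\<^sub>R axis m \<i>)"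
    by (simp add: vec_eq_iff axis_def if_distrib[of "(*\<^sub>R) _"] sum.distrib complex_eq_iff
        if_distrib[of Re] if_distrib[of Im] cong: if_cong)
  then have "L w = L (\<Sum>m\<in>UNIV. Re (w $ m) *\<^sub>R axis m 1 + Im (w $ m) *\<^sub>R axis m \<i>)"
    by (rule arg_cong)
  also have "\<dots> = (\<Sum>m\<in>UNIV. Re (w $ m) *\<^sub>R L (axis m 1) + Im (w $ m) *\<^sub>R L (axis m \<i>))"
    by (simp add: linear_sum[OF assms] linear_add[OF assms] linear_scale[OF assms])
  also have "\<dots> = (\<Sum>m\<in>UNIV.
      (L (axis m 1) - \<i> * L (axis m \<i>)) / 2 * elementary_functional (m, True) w +
      (L (axis m 1) + \<i> * L (axis m \<i>)) / 2 * elementary_functional (m, False) w)"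
    by (intro sum.cong refl) (simp add: elementary_functional_def complex_eq_iff field_simps)
  finally show ?thesis .
qed

text \<open>Stated as an induction principle, which avoids naming the coefficients of the expansion into
  monomials.\<close>

lemma multilinear_induct:
  fixes F :: "(nat \<Rightarrow> complex^'n::finite) \<Rightarrow> complex"
  assumes "\<And>v w. (\<And>i. i < m \<Longrightarrow> v i = w i) \<Longrightarrow> F v = F w"
    and "\<And>v i. i < m \<Longrightarrow> linear (\<lambda>w. F (v(i := w)))"
    and "\<And>f g. Q f \<Longrightarrow> Q g \<Longrightarrow> Q (\<lambda>v. f v + g v)"
    and "\<And>f c. Q f \<Longrightarrow> Q (\<lambda>v. c * f v)"
    and "\<And>s. Q (\<lambda>v. \<Prod>i<m. elementary_functional (s i) (v i))"
  shows "Q F"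
  using assms
proof (induction m arbitrary: F Q)
  case 0
  have "F = (\<lambda>v. F 0 * 1)"
    using 0(1) by auto
  then show ?case
    using 0(4)[OF 0(5), of "F 0"] by simp
next
  case (Suc m)
  \<comment> \<open>The coefficients of the expansion of \<open>F\<close> in its last argument. That
    argument is replaced by basis vectors, so \<open>G t\<close> is multilinear in the first
    \<open>m\<close> arguments.\<close>
  define G where "G t v = (if snd t then (F (v(m := axis (fst t) 1)) - \<i> * F (v(m := axis (fst t) \<i>))) / 2
      else (F (v(m := axis (fst t) 1)) + \<i> * F (v(m := axis (fst t) \<i>))) / 2)" for t v
  have Q_sum: "Q (\<lambda>v. \<Sum>t\<in>T. f t v)" if "finite T" "\<And>t. t \<in> T \<Longrightarrow> Q (f t)"
    for T :: "'n set" and f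
    using that
  proof (induction rule: finite_induct)
    case empty
    show ?case
      using Suc.prems(4)[OF Suc.prems(5), of 0] by simp
  next
    case (insert x T)
    then show ?case
      by (simp add: Suc.prems(3))
  qed
  have Q_G: "Q (\<lambda>v. G t v * elementary_functional t (v m))" for t
  \<comment> \<open>The induction hypothesis is used with a modified predicate that carries the
    functional of the last argument along as a fixed factor.\<close>
  proof (rule Suc.IH[where Q = "\<lambda>f. Q (\<lambda>v. f v * elementary_functional t (v m))"])
    show "G t v = G t w" if "\<And>i. i < m \<Longrightarrow> v i = w i" for v w
    proof -
      have "F (v(m := z)) = F (w(m := z))" for z
        using that by (intro Suc.prems(1)) (auto simp: less_Suc_eq)
      then show ?thesis
        by (simp add: G_def)
    qed
    show "linear (\<lambda>w. G t (v(i := w)))" if "i < m" for v i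
    proof -
      have *: "linear (\<lambda>w. F (v(i := w, m := z)))" for z
      proof -
        have "v(m := z, i := w) = v(i := w, m := z)" for w
          using that by (intro fun_upd_twist) simp
        then show ?thesis
          using Suc.prems(2)[of i "v(m := z)"] that by (simp only: less_SucI)
      qed
      show ?thesis
        by (rule linearI)
          (simp_all add: G_def linear_add[OF *] linear_scale[OF *] field_simps
            scaleR_conv_of_real[where 'a = complex])
    qed
    show "Q (\<lambda>v. (f v + g v) * elementary_functional t (v m))"
      if "Q (\<lambda>v. f v * elementary_functional t (v m))" "Q (\<lambda>v. g v * elementary_functional t (v m))"
      for f g
      using Suc.prems(3)[OF that] by (simp add: distrib_right)
    show "Q (\<lambda>v. c * f v * elementary_functional t (v m))"
      if "Q (\<lambda>v. f v * elementary_functional t (v m))" for f c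
      using Suc.prems(4)[OF that, of c] by (simp add: mult.assoc)
    show "Q (\<lambda>v. (\<Prod>i<m. elementary_functional (s i) (v i)) * elementary_functional t (v m))" for s
    proof -
      have "(\<Prod>i<m. elementary_functional ((s(m := t)) i) (v i)) =
          (\<Prod>i<m. elementary_functional (s i) (v i))" for v
        by (intro prod.cong) auto
      then show ?thesis
        using Suc.prems(5)[of "s(m := t)"] by simp
    qed
  qed
  have "F v = (\<Sum>j\<in>UNIV. G (j, True) v * elementary_functional (j, True) (v m) +
      G (j, False) v * elementary_functional (j, False) (v m))" for v
  proof -
    have "linear (\<lambda>w. F (v(m := w)))"
      by (rule Suc.prems(2)) simp
    from real_linear_functional_expansion[OF this, of "v m"] show ?thesis
      by (simp only: G_def fun_upd_triv fst_conv snd_conv simp_thms if_True if_False)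
  qed
  then have "F = (\<lambda>v. \<Sum>j\<in>UNIV. G (j, True) v * elementary_functional (j, True) (v m) +
      G (j, False) v * elementary_functional (j, False) (v m))"
    by blast
  then show ?case
    using Q_sum[OF finite] Suc.prems(3)[OF Q_G Q_G] by simp
qed

section \<open>Linear combinations of covectors of pure type\<close>

lemma pq_covectors_add:
  assumes "f \<in> pq_covectors p q" "g \<in> pq_covectors p q"
  shows "(\<lambda>v. f v + g v) \<in> pq_covectors p q"
proof -
  obtain c d where
    "f = (\<lambda>v. \<Sum>I\<in>{..<p} \<rightarrow>\<^sub>E UNIV. \<Sum>J\<in>{..<q} \<rightarrow>\<^sub>E UNIV. c I J * dz_dzbar p q I J v)"
    "g = (\<lambda>v. \<Sum>I\<in>{..<p} \<rightarrow>\<^sub>E UNIV. \<Sum>J\<in>{..<q} \<rightarrow>\<^sub>E UNIV. d I J * dz_dzbar p q I J v)"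
    using assms unfolding pq_covectors_def by blast
  then show ?thesis
    unfolding pq_covectors_def
    by (auto intro!: exI[of _ "\<lambda>I J. c I J + d I J"] simp: sum.distrib distrib_right)
qed

lemma pq_covectors_scale:
  assumes "f \<in> pq_covectors p q"
  shows "(\<lambda>v. c * f v) \<in> pq_covectors p q"
proof -
  obtain d where
    "f = (\<lambda>v. \<Sum>I\<in>{..<p} \<rightarrow>\<^sub>E UNIV. \<Sum>J\<in>{..<q} \<rightarrow>\<^sub>E UNIV. d I J * dz_dzbar p q I J v)"
    using assms unfolding pq_covectors_def by blast
  then show ?thesis
    unfolding pq_covectors_def
    by (auto intro!: exI[of _ "\<lambda>I J. c * d I J"] simp: sum_distrib_left mult.assoc)
qed

lemma zero_in_pq_covectors: "(\<lambda>v. 0) \<in> pq_covectors p q"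
  unfolding pq_covectors_def by (auto intro!: exI[of _ "\<lambda>I J. 0"])

text \<open>The span is indexed by extensional functions. Only the entries of \<open>I\<close> below
  \<open>p\<close> and of \<open>J\<close> below \<open>q\<close> matter, so restricting them yields
  a generator, selected by indicator coefficients.\<close>

lemma dz_dzbar_in_pq_covectors: "dz_dzbar p q I J \<in> pq_covectors p q"
proof -
  let ?I = "restrict I {..<p}" and ?J = "restrict J {..<q}"
  have eq: "dz_dzbar p q I J = dz_dzbar p q ?I ?J"
    by (simp add: dz_dzbar_def fun_eq_iff)
  have "dz_dzbar p q ?I ?J v = (\<Sum>I'\<in>{..<p} \<rightarrow>\<^sub>E UNIV. \<Sum>J'\<in>{..<q} \<rightarrow>\<^sub>E UNIV.
      (if I' = ?I then if J' = ?J then 1 else 0 else 0) * dz_dzbar p q I' J' v)" for v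
  proof -
    have "(\<Sum>J'\<in>{..<q} \<rightarrow>\<^sub>E UNIV. (if I' = ?I then if J' = ?J then 1 else 0 else 0) * dz_dzbar p q I' J' v)
        = (if I' = ?I then dz_dzbar p q ?I ?J v else 0)" for I'
      by (auto simp: if_distrib[of "\<lambda>x. x * _"] finite_PiE cong: if_cong)
    then show ?thesis
      by (simp add: finite_PiE)
  qed
  then show ?thesis
    unfolding eq by (auto simp: pq_covectors_def fun_eq_iff intro!: exI)
qed

section \<open>The type decomposition\<close>

text \<open>Not divided by \<open>k!\<close>, so that a monomial in the elementary functionals
  becomes, up to sign, a wedge product as given by \<open>dz_dzbar\<close>.\<close>

definition alternatization :: "nat \<Rightarrow> 'n covector \<Rightarrow> 'n covector" where
  "alternatization k F v = (\<Sum>\<sigma> | \<sigma> permutes {..<k}. of_int (sign \<sigma>) * F (v \<circ> \<sigma>))"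

lemma alternatization_covector:
  assumes "\<omega> \<in> covectors k"
  shows "alternatization k \<omega> v = fact k * \<omega> v"
proof -
  have "of_int (sign \<sigma>) * \<omega> (v \<circ> \<sigma>) = \<omega> v" if "\<sigma> permutes {..<k}" for \<sigma>
    by (simp add: covectors_permute[OF assms that] sign_def)
  then show ?thesis
    by (simp add: alternatization_def card_permutations)
qed

text \<open>Serves to move the holomorphic factors of a monomial in front of the antiholomorphic
  ones. Two bijections, onto the indices with \<open>P\<close> and onto the others, are
  glued.\<close>

lemma exists_sorting_permutation:
  fixes P :: "nat \<Rightarrow> bool"
  obtains \<tau> p where "\<tau> permutes {..<k}" "p \<le> k" "\<And>i. i < k \<Longrightarrow> P (\<tau> i) \<longleftrightarrow> i < p"
proof -
  define T where "T = {i. i < k \<and> P i}"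
  define p where "p = card T"
  have T: "T \<subseteq> {..<k}"
    by (auto simp: T_def)
  then have fin: "finite T" and p: "p \<le> k"
    using card_mono[of "{..<k}" T] finite_subset by (auto simp: p_def)
  obtain f where f: "bij_betw f {..<p} T"
    using finite_same_card_bij[of "{..<p}" T] fin by (auto simp: p_def)
  obtain g where g: "bij_betw g {p..<k} ({..<k} - T)"
    using finite_same_card_bij[of "{p..<k}" "{..<k} - T"] fin T
    by (auto simp: p_def card_Diff_subset)
  define \<tau> where "\<tau> i = (if i < p then f i else if i < k then g i else i)" for i
  have "bij_betw \<tau> {..<p} T"
    using f by (subst bij_betw_cong[of _ \<tau> f]) (auto simp: \<tau>_def)
  moreover have "bij_betw \<tau> {p..<k} ({..<k} - T)"
    using g by (subst bij_betw_cong[of _ \<tau> g]) (auto simp: \<tau>_def)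
  ultimately have "bij_betw \<tau> ({..<p} \<union> {p..<k}) (T \<union> ({..<k} - T))"
    by (intro bij_betw_combine) auto
  moreover have "{..<p} \<union> {p..<k} = {..<k}" "T \<union> ({..<k} - T) = {..<k}"
    using p T by auto
  ultimately have "\<tau> permutes {..<k}"
    using p by (intro bij_imp_permutes) (auto simp: \<tau>_def)
  moreover have "P (\<tau> i) \<longleftrightarrow> i < p" if "i < k" for i
    using bij_betwE[OF f] bij_betwE[OF g] that by (auto simp: \<tau>_def T_def)
  ultimately show ?thesis
    using that p by blast
qed

text \<open>Here \<open>p\<close> is the number of holomorphic factors. After sorting the factors by
  \<open>\<tau>\<close>, the summand for \<open>\<sigma>\<close> is that of the determinant for
  \<open>\<sigma> \<circ> \<tau>\<close>; reindexing the sum costs the sign of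
  \<open>\<tau>\<close>.\<close>

lemma alternatization_monomial:
  obtains p where "p \<le> k"
    "alternatization k (\<lambda>v. \<Prod>i<k. elementary_functional (s i) (v i)) \<in> pq_covectors p (k - p)"
proof -
  obtain \<tau> p where \<tau>: "\<tau> permutes {..<k}" and p: "p \<le> k"
    and sorted: "\<And>i. i < k \<Longrightarrow> snd (s (\<tau> i)) \<longleftrightarrow> i < p"
    using exists_sorting_permutation[of k "\<lambda>i. snd (s i)"] by metis
  define I where "I i = fst (s (\<tau> i))" for i
  define J where "J i = fst (s (\<tau> (p + i)))" for i
  have "alternatization k (\<lambda>v. \<Prod>i<k. elementary_functional (s i) (v i)) v =
      of_int (sign \<tau>) * dz_dzbar p (k - p) I J v" for v
  proof -
    have "of_int (sign \<sigma>) * (\<Prod>i<k. elementary_functional (s i) ((v \<circ> \<sigma>) i)) =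
        of_int (sign \<tau>) * (of_int (sign (\<sigma> \<circ> \<tau>)) *
        ((\<Prod>a<p. v ((\<sigma> \<circ> \<tau>) a) $ I a) * (\<Prod>b<k - p. cnj (v ((\<sigma> \<circ> \<tau>) (p + b)) $ J b))))"
      if \<sigma>: "\<sigma> permutes {..<k}" for \<sigma>
    proof -
      have perm: "permutation \<sigma>" "permutation \<tau>"
        using \<sigma> \<tau> permutes_imp_permutation by blast+
      let ?h = "\<lambda>i. elementary_functional (s (\<tau> i)) (v (\<sigma> (\<tau> i)))"
      have "(\<Prod>i<k. elementary_functional (s i) (v (\<sigma> i))) = prod ?h {..<k}"
        using prod.permute[OF \<tau>, of "\<lambda>i. elementary_functional (s i) (v (\<sigma> i))"]
        by (simp add: o_def)
      also have "\<dots> = prod ?h {..<p} * prod ?h {p..<k}"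
        using p by (subst prod.union_disjoint[symmetric]) (auto intro!: prod.cong)
      also have "prod ?h {p..<k} = (\<Prod>b<k - p. ?h (p + b))"
        using prod.shift_bounds_nat_ivl[of ?h 0 p "k - p"] p
        by (simp add: atLeast0LessThan add.commute)
      also have "prod ?h {..<p} = (\<Prod>a<p. v ((\<sigma> \<circ> \<tau>) a) $ I a)"
        using sorted p by (intro prod.cong) (auto simp: elementary_functional_def I_def)
      also have "(\<Prod>b<k - p. ?h (p + b)) = (\<Prod>b<k - p. cnj (v ((\<sigma> \<circ> \<tau>) (p + b)) $ J b))"
        using sorted p by (intro prod.cong) (auto simp: elementary_functional_def J_def)
      finally have *: "(\<Prod>i<k. elementary_functional (s i) (v (\<sigma> i))) =
        (\<Prod>a<p. v ((\<sigma> \<circ> \<tau>) a) $ I a) * (\<Prod>b<k - p. cnj (v ((\<sigma> \<circ> \<tau>) (p + b)) $ J b))" .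
      have "sign \<sigma> = sign \<tau> * sign (\<sigma> \<circ> \<tau>)"
        by (simp add: sign_compose perm)
      then show ?thesis
        using * by (simp add: mult.assoc)
    qed
    then have "alternatization k (\<lambda>v. \<Prod>i<k. elementary_functional (s i) (v i)) v =
        (\<Sum>\<sigma> | \<sigma> permutes {..<k}. of_int (sign \<tau>) * (of_int (sign (\<sigma> \<circ> \<tau>)) *
        ((\<Prod>a<p. v ((\<sigma> \<circ> \<tau>) a) $ I a) * (\<Prod>b<k - p. cnj (v ((\<sigma> \<circ> \<tau>) (p + b)) $ J b)))))"
      unfolding alternatization_def by (intro sum.cong refl) blast
    also have "\<dots> = of_int (sign \<tau>) * dz_dzbar p (k - p) I J v"
      using p sum_permutations_compose_right[OF \<tau>, of "\<lambda>\<sigma>. of_int (sign \<sigma>) *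
        ((\<Prod>a<p. v (\<sigma> a) $ I a) * (\<Prod>b<k - p. cnj (v (\<sigma> (p + b)) $ J b)))"]
      by (simp add: dz_dzbar_def sum_distrib_left)
    finally show ?thesis .
  qed
  then have "alternatization k (\<lambda>v. \<Prod>i<k. elementary_functional (s i) (v i)) =
      (\<lambda>v. of_int (sign \<tau>) * dz_dzbar p (k - p) I J v)"
    by blast
  then show ?thesis
    using that p pq_covectors_scale[OF dz_dzbar_in_pq_covectors] by metis
qed

text \<open>Monomials are not alternating, so the induction decomposes the alternatization of
  \<open>F\<close> instead of \<open>F\<close>. For the alternating \<open>\<omega>\<close> this is
  a decomposition of \<open>k!\<close> times \<open>\<omega>\<close>, and \<open>k!\<close> is
  divided out at the end.\<close>

lemma pq_decomposition_exists:
  fixes \<omega> :: "'n::finite covector"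
  assumes "\<omega> \<in> covectors k"
  shows "\<exists>f. (\<forall>p\<le>k. f p \<in> pq_covectors p (k - p)) \<and> (\<forall>v. \<omega> v = (\<Sum>p\<le>k. f p v))"
proof -
  let ?Q = "\<lambda>F :: 'n covector. \<exists>f. (\<forall>p\<le>k. f p \<in> pq_covectors p (k - p)) \<and>
    (\<forall>v. alternatization k F v = (\<Sum>p\<le>k. f p v))"
  have "?Q \<omega>"
  proof (rule multilinear_induct[where m = k and Q = ?Q])
    show "\<omega> v = \<omega> w" if "\<And>i. i < k \<Longrightarrow> v i = w i" for v w
      using covectors_cong assms that by blast
    show "linear (\<lambda>w. \<omega> (v(i := w)))" if "i < k" for v i
      using covectors_linear assms that by blast
    show "?Q (\<lambda>v. F v + G v)" if QF: "?Q F" and QG: "?Q G" for F G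
    proof -
      obtain f where f: "\<forall>p\<le>k. f p \<in> pq_covectors p (k - p)"
        "\<forall>v. alternatization k F v = (\<Sum>p\<le>k. f p v)"
        using QF by blast
      obtain g where g: "\<forall>p\<le>k. g p \<in> pq_covectors p (k - p)"
        "\<forall>v. alternatization k G v = (\<Sum>p\<le>k. g p v)"
        using QG by blast
      have "alternatization k (\<lambda>v. F v + G v) v = (\<Sum>p\<le>k. f p v + g p v)" for v
        using f(2) g(2) by (simp add: alternatization_def distrib_left sum.distrib)
      then show ?thesis
        using f(1) g(1) pq_covectors_add
        by (intro exI[of _ "\<lambda>p v. f p v + g p v"]) blast
    qed
    show "?Q (\<lambda>v. c * F v)" if QF: "?Q F" for F c
    proof -
      obtain f where f: "\<forall>p\<le>k. f p \<in> pq_covectors p (k - p)"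
        "\<forall>v. alternatization k F v = (\<Sum>p\<le>k. f p v)"
        using QF by blast
      have "alternatization k (\<lambda>v. c * F v) v = c * alternatization k F v" for v
        by (simp add: alternatization_def sum_distrib_left algebra_simps)
      then have "alternatization k (\<lambda>v. c * F v) v = (\<Sum>p\<le>k. c * f p v)" for v
        using f(2) by (simp add: sum_distrib_left)
      then show ?thesis
        using f(1) pq_covectors_scale by (intro exI[of _ "\<lambda>p v. c * f p v"]) blast
    qed
    show "?Q (\<lambda>v. \<Prod>i<k. elementary_functional (s i) (v i))" for s
    proof -
      let ?M = "alternatization k (\<lambda>v. \<Prod>i<k. elementary_functional (s i) (v i))"
      obtain r where r: "r \<le> k" "?M \<in> pq_covectors r (k - r)"
        using alternatization_monomial by blast
      define f where "f p = (if p = r then ?M else (\<lambda>v. 0))" for p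
      have f: "\<forall>p\<le>k. f p \<in> pq_covectors p (k - p)"
        using r(2) by (simp add: f_def zero_in_pq_covectors)
      have "(\<Sum>p\<le>k. f p v) = (\<Sum>p\<le>k. if p = r then ?M v else 0)" for v
        by (intro sum.cong) (simp_all add: f_def)
      then have "\<forall>v. ?M v = (\<Sum>p\<le>k. f p v)"
        using r(1) by simp
      with f show ?thesis
        by (intro exI[of _ f] conjI)
    qed
  qed
  then obtain f where f: "\<forall>p\<le>k. f p \<in> pq_covectors p (k - p)"
      "\<forall>v. fact k * \<omega> v = (\<Sum>p\<le>k. f p v)"
    by (auto simp: alternatization_covector[OF assms])
  have "\<omega> v = (\<Sum>p\<le>k. inverse (fact k) * f p v)" for v
    by (simp add: sum_distrib_left[symmetric] f(2)[rule_format, symmetric])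
  then show ?thesis
    using f(1) pq_covectors_scale by (intro exI[of _ "\<lambda>p v. inverse (fact k) * f p v"]) blast
qed

text \<open>Each summand of the determinant has \<open>p\<close> factors linear and \<open>q\<close>
  factors conjugate-linear over the complex numbers.\<close>

lemma pq_covectors_homogeneous:
  assumes "f \<in> pq_covectors p q"
  shows "f (\<lambda>i. c *s v i) = c ^ p * cnj c ^ q * f v"
proof -
  have *: "dz_dzbar p q I J (\<lambda>i. c *s v i) = c ^ p * cnj c ^ q * dz_dzbar p q I J v" for I J
    by (simp add: dz_dzbar_def prod.distrib sum_distrib_left algebra_simps)
  show ?thesis
    using assms by (auto simp: pq_covectors_def * sum_distrib_left algebra_simps)
qed

text \<open>Averaging over the \<open>2(k + 1)\<close>-th roots of unity \<open>c = cis (j\<pi> / (k + 1))\<close>, \<open>j \<le> k\<close>: a covector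
  of type \<open>(p, k - p)\<close> has weight \<open>2p - k\<close> under \<open>v \<mapsto> c v\<close>.\<close>

definition pq_projection :: "nat \<Rightarrow> nat \<Rightarrow> 'n::finite covector \<Rightarrow> 'n covector" where
  "pq_projection k p \<omega> v = (\<Sum>j\<le>k. cis (- (2 * real p - real k) * (real j * pi / (real k + 1))) /
     (of_nat k + 1) * \<omega> (\<lambda>i. cis (real j * pi / (real k + 1)) *s v i))"

text \<open>For \<open>r \<noteq> p\<close> this is a geometric sum over the powers of a
  \<open>(k + 1)\<close>-th root of unity \<open>z\<close>. It vanishes because \<open>z = 1\<close>
  would make \<open>k + 1\<close> divide \<open>r - p\<close>, which is nonzero and of absolute
  value at most \<open>k\<close>.\<close>

lemma sum_roots_of_unity:
  assumes "p \<le> k" "r \<le> k"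
  shows "(\<Sum>j\<le>k. cis (2 * (real r - real p) * (real j * pi / (real k + 1)))) =
    (if r = p then of_nat k + 1 else 0)"
proof (cases "r = p")
  case False
  define z where "z = cis (2 * (real r - real p) * pi / (real k + 1))"
  have "z \<noteq> 1"
  proof
    assume "z = 1"
    then obtain m :: int where "2 * (real r - real p) * pi / (real k + 1) = of_int m * (2 * pi)"
      by (auto simp: z_def cis_eq_1_iff)
    then have "real r - real p = of_int m * (real k + 1)"
      by (simp add: divide_simps) (simp add: algebra_simps)
    then have "of_int (int r - int p) = (of_int (m * (int k + 1)) :: real)"
      by simp
    then have "int r - int p = m * (int k + 1)"
      by (simp only: of_int_eq_iff)
    then have "int k + 1 dvd int r - int p"
      by simp
    then have "int k + 1 \<le> \<bar>int r - int p\<bar>"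
      using False by (intro zdvd_imp_le) auto
    then show False
      using assms by simp
  qed
  have "cis (2 * (real r - real p) * (real j * pi / (real k + 1))) = z ^ j" for j
    by (simp add: z_def Complex.DeMoivre mult_ac)
  moreover have "z ^ Suc k = cis (2 * pi * of_int (int r - int p))"
    unfolding z_def Complex.DeMoivre by (intro arg_cong[of _ _ cis]) (simp add: field_simps)
  ultimately show ?thesis
    using False \<open>z \<noteq> 1\<close>
    by (simp add: lessThan_Suc_atMost[symmetric] sum_gp_strict del: sum.lessThan_Suc power_Suc)
qed simp

text \<open>On the unit circle conjugation is inversion, so \<open>f\<close> has weight
  \<open>2 r - k\<close>. Against the averaging weight there remains \<open>2 (r - p)\<close>, and
  the sum over roots of unity selects \<open>r = p\<close>.\<close>

lemma pq_projection_pure: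
  assumes "f \<in> pq_covectors r (k - r)" "r \<le> k" "p \<le> k"
  shows "pq_projection k p f v = (if r = p then f v else 0)"
proof -
  have "cis (- (2 * real p - real k) * t) / (of_nat k + 1) * f (\<lambda>i. cis t *s v i) =
      f v / (of_nat k + 1) * cis (2 * (real r - real p) * t)" for t
  proof -
    have "cis (- (2 * real p - real k) * t) * (cis t ^ r * cnj (cis t) ^ (k - r)) =
        cis (2 * (real r - real p) * t)"
      using assms(2)
      by (simp only: cis_cnj Complex.DeMoivre cis_mult of_nat_diff) (simp add: algebra_simps)
    then show ?thesis
      by (simp add: pq_covectors_homogeneous[OF assms(1)] field_simps)
  qed
  then have "pq_projection k p f v = (\<Sum>j\<le>k. f v / (of_nat k + 1) *
      cis (2 * (real r - real p) * (real j * pi / (real k + 1))))"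
    unfolding pq_projection_def by (intro sum.cong refl)
  then have "pq_projection k p f v =
      f v / (of_nat k + 1) * (\<Sum>j\<le>k. cis (2 * (real r - real p) * (real j * pi / (real k + 1))))"
    by (simp only: sum_distrib_left)
  also have "\<dots> = (if r = p then f v else 0)"
    unfolding sum_roots_of_unity[OF assms(3,2)]
    using of_nat_neq_0[of k, where 'a = complex] by (simp add: add.commute)
  finally show ?thesis .
qed

lemma pq_projection_sum:
  assumes "\<forall>r\<le>k. f r \<in> pq_covectors r (k - r)" "p \<le> k"
  shows "pq_projection k p (\<lambda>v. \<Sum>r\<le>k. f r v) v = f p v"
proof -
  have "pq_projection k p (\<lambda>v. \<Sum>r\<le>k. f r v) v = (\<Sum>r\<le>k. pq_projection k p (f r) v)"
    unfolding pq_projection_def sum_distrib_left by (rule sum.swap)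
  also have "\<dots> = (\<Sum>r\<le>k. if r = p then f r v else 0)"
    using assms by (intro sum.cong refl pq_projection_pure) auto
  finally show ?thesis
    using assms(2) by simp
qed

text \<open>Uniqueness behind the definite description: \<open>pq_projection\<close> recovers every
  member of a decomposition from its sum. Extending \<open>f\<close> by \<open>0\<close> above
  \<open>k\<close> meets the convention of \<open>pq_component\<close>.\<close>

lemma pq_component_eqI:
  assumes "\<forall>p\<le>k. f p \<in> pq_covectors p (k - p)" "\<And>v. \<omega> v = (\<Sum>p\<le>k. f p v)" "p \<le> k"
  shows "pq_component k \<omega> p = f p"
proof -
  let ?g = "\<lambda>p. if p \<le> k then f p else 0"
  have "pq_component k \<omega> = ?g"
    unfolding pq_component_def
  proof (rule the_equality)
    show "(\<forall>p\<le>k. ?g p \<in> pq_covectors p (k - p)) \<and> (\<forall>p>k. ?g p = 0) \<and> \<omega> = sum ?g {..k}"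
      using assms by (simp add: fun_eq_iff sum_fun_apply)
    fix h
    assume h: "(\<forall>p\<le>k. h p \<in> pq_covectors p (k - p)) \<and> (\<forall>p>k. h p = 0) \<and> \<omega> = sum h {..k}"
    have "h q = ?g q" for q
    proof (cases "q \<le> k")
      case True
      have "(\<lambda>v. \<Sum>p\<le>k. f p v) = (\<lambda>v. \<Sum>p\<le>k. h p v)"
        using h assms(2) by (metis sum_fun_apply)
      then have "h q v = f q v" for v
        using pq_projection_sum[of k f q v] pq_projection_sum[of k h q v] h assms(1) True by simp
      then show ?thesis
        using True by auto
    qed (use h in auto)
    then show "h = ?g"
      by blast
  qed
  then show ?thesis
    using assms(3) by simp
qed

lemma
  assumes "\<omega> \<in> covectors k"
  shows pq_component_in_pq_covectors: "p \<le> k \<Longrightarrow> pq_component k \<omega> p \<in> pq_covectors p (k - p)"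
    and sum_pq_component: "(\<Sum>p\<le>k. pq_component k \<omega> p v) = \<omega> v"
    and pq_component_eq_projection: "p \<le> k \<Longrightarrow> pq_component k \<omega> p = pq_projection k p \<omega>"
proof -
  obtain f where f: "\<forall>p\<le>k. f p \<in> pq_covectors p (k - p)" "\<And>v. \<omega> v = (\<Sum>p\<le>k. f p v)"
    using pq_decomposition_exists[OF assms] by blast
  have eq: "pq_component k \<omega> p = f p" if "p \<le> k" for p
    using pq_component_eqI[OF f that] .
  show "pq_component k \<omega> p \<in> pq_covectors p (k - p)" if "p \<le> k"
    using eq f that by simp
  show "(\<Sum>p\<le>k. pq_component k \<omega> p v) = \<omega> v"
    using eq f(2) by simp
  have "\<omega> = (\<lambda>v. \<Sum>p\<le>k. f p v)"
    using f(2) by blast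
  then show "pq_component k \<omega> p = pq_projection k p \<omega>" if "p \<le> k"
    using eq[OF that] pq_projection_sum[OF f(1) that] by auto
qed

section \<open>Closure properties of the space of covectors\<close>

lemma covectors_add:
  assumes "\<omega> \<in> covectors k" "\<omega>' \<in> covectors k"
  shows "(\<lambda>v. \<omega> v + \<omega>' v) \<in> covectors k"
proof (rule covectorsI)
  show "\<omega> v + \<omega>' v = \<omega> w + \<omega>' w" if "\<And>i. i < k \<Longrightarrow> v i = w i" for v w
    using covectors_cong[OF assms(1) that] covectors_cong[OF assms(2) that] by simp
  show "linear (\<lambda>w. \<omega> (v(i := w)) + \<omega>' (v(i := w)))" if "i < k" for v i
    by (intro linear_compose_add covectors_linear[OF assms(1) that] covectors_linear[OF assms(2) that])
  show "\<omega> v + \<omega>' v = 0" if "i < j" "j < k" "v i = v j" for v i j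
    using covectors_alternating[OF assms(1), of i j v] covectors_alternating[OF assms(2), of i j v] that
    by simp
qed

lemma covectors_scale:
  assumes "\<omega> \<in> covectors k"
  shows "(\<lambda>v. c * \<omega> v) \<in> covectors k"
proof (rule covectorsI)
  show "c * \<omega> v = c * \<omega> w" if "\<And>i. i < k \<Longrightarrow> v i = w i" for v w
    using covectors_cong[OF assms that] by simp
  show "linear (\<lambda>w. c * \<omega> (v(i := w)))" if "i < k" for v i
    using linear_compose[OF covectors_linear[OF assms that] linear_times, of c] by (simp only: o_def)
  show "c * \<omega> v = 0" if "i < j" "j < k" "v i = v j" for v i j
    using covectors_alternating[OF assms, of i j v] that by simp
qed

lemma covectors_sum:
  "(\<And>i. i \<in> I \<Longrightarrow> f i \<in> covectors k) \<Longrightarrow> (\<lambda>v. \<Sum>i\<in>I. f i v) \<in> covectors k"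
  by (induction I rule: infinite_finite_induct)
    (auto intro: covectors_add simp: zero_in_covectors[unfolded zero_fun_def])

lemma covectors_complex_scaled_arguments:
  assumes "\<omega> \<in> covectors k"
  shows "(\<lambda>v. \<omega> (\<lambda>i. c *s v i)) \<in> covectors k"
proof (rule covectorsI)
  show "\<omega> (\<lambda>i. c *s v i) = \<omega> (\<lambda>i. c *s w i)" if "\<And>i. i < k \<Longrightarrow> v i = w i" for v w
    using that by (intro covectors_cong[OF assms]) simp
  show "linear (\<lambda>w. \<omega> (\<lambda>j. c *s (v(i := w)) j))" if "i < k" for v i
  proof -
    have *: "linear (\<lambda>w. \<omega> ((\<lambda>j. c *s v j)(i := w)))"
      by (rule covectors_linear[OF assms that])
    have eq: "(\<lambda>j. c *s (v(i := w)) j) = (\<lambda>j. c *s v j)(i := c *s w)" for w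
      by auto
    have "linear ((*s) c :: complex^'a \<Rightarrow> _)"
      by (rule linearI) (simp_all add: vec_eq_iff algebra_simps)
    from linear_compose[OF this *] show ?thesis
      unfolding eq o_def .
  qed
  show "\<omega> (\<lambda>i. c *s v i) = 0" if "i < j" "j < k" "v i = v j" for v i j
    using covectors_alternating[OF assms, of i j "\<lambda>i. c *s v i"] that by simp
qed

lemma pq_projection_in_covectors:
  "\<omega> \<in> covectors k \<Longrightarrow> pq_projection k p \<omega> \<in> covectors k"
  unfolding pq_projection_def[abs_def]
  by (intro covectors_sum covectors_scale covectors_complex_scaled_arguments)

section \<open>Forms on the manifold\<close>

text \<open>The pointwise conditions on forms alone: wide enough to contain
  \<open>ext_deriv A k u\<close> for smooth \<open>u\<close>, and strict enough for
  \<open>theta\<close> with nonvanishing \<open>\<eta>\<close> to be injective.\<close>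

definition covector_fields :: "('x, 'n::finite) chart set \<Rightarrow> nat \<Rightarrow> ('x, 'n) form set" where
  "covector_fields A k = {u. (\<forall>a y. u a y \<in> covectors k) \<and>
     (\<forall>a y. a \<notin> A \<or> y \<notin> chart_image a \<longrightarrow> u a y = 0)}"

lemma covector_fieldsI:
  assumes "\<And>a y. u a y \<in> covectors k" "\<And>a y. a \<notin> A \<or> y \<notin> chart_image a \<Longrightarrow> u a y = 0"
  shows "u \<in> covector_fields A k"
  using assms unfolding covector_fields_def by blast

lemma covector_fields_covectors: "u \<in> covector_fields A k \<Longrightarrow> u a y \<in> covectors k"
  unfolding covector_fields_def by blast

lemma covector_fields_outside:
  "u \<in> covector_fields A k \<Longrightarrow> a \<notin> A \<or> y \<notin> chart_image a \<Longrightarrow> u a y = 0"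
  unfolding covector_fields_def by blast

lemma smooth_forms_covector_fields: "smooth_forms A k \<subseteq> covector_fields A k"
proof
  fix u assume u: "u \<in> smooth_forms A k"
  then have outside: "u a y = 0" if "a \<notin> A \<or> y \<notin> chart_image a" for a y
    using that unfolding smooth_forms_def by blast
  have "u a y \<in> covectors k" for a y
  proof (cases "a \<in> A \<and> y \<in> chart_image a")
    case True
    then show ?thesis
      using u unfolding smooth_forms_def by blast
  next
    case False
    then show ?thesis
      using outside zero_in_covectors by metis
  qed
  then show "u \<in> covector_fields A k"
    using outside by (rule covector_fieldsI)
qed

lemma smooth_formsI:
  assumes "u \<in> covector_fields A k"
    and "\<And>a v. a \<in> A \<Longrightarrow> smooth_on (chart_image a) (\<lambda>y. u a y v)"
    and "\<And>a b y v. a \<in> A \<Longrightarrow> b \<in> A \<Longrightarrow> y \<in> snd a ` (fst a \<inter> fst b) \<Longrightarrow>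
      u a y v = u b (transition a b y) (\<lambda>i. frechet_derivative (transition a b) (at y) (v i))"
  shows "u \<in> smooth_forms A k"
  using assms unfolding smooth_forms_def covector_fields_def by blast

lemma smooth_forms_smooth:
  "u \<in> smooth_forms A k \<Longrightarrow> a \<in> A \<Longrightarrow> smooth_on (chart_image a) (\<lambda>y. u a y v)"
  unfolding smooth_forms_def by blast

lemma smooth_forms_transform:
  "u \<in> smooth_forms A k \<Longrightarrow> a \<in> A \<Longrightarrow> b \<in> A \<Longrightarrow> y \<in> snd a ` (fst a \<inter> fst b) \<Longrightarrow>
    u a y v = u b (transition a b y) (\<lambda>i. frechet_derivative (transition a b) (at y) (v i))"
  unfolding smooth_forms_def by blast

lemma zero_in_covector_fields: "0 \<in> covector_fields A k"
  by (rule covector_fieldsI) (simp_all add: zero_in_covectors)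

text \<open>Replaces the definite description by finite averages of values of \<open>u\<close>, from
  which linearity, smoothness and behaviour under changes of charts can be read off.\<close>

lemma theta_eq:
  assumes "u \<in> covector_fields A k"
  shows "theta \<eta> k u a y v =
    (\<Sum>p\<le>k. of_real (\<eta> (chart_inv a y) ^ p) * pq_projection k p (u a y) v)"
  unfolding theta_def
  by (intro sum.cong refl)
    (simp add: pq_component_eq_projection[OF covector_fields_covectors[OF assms]])

lemma theta_in_covector_fields:
  assumes "u \<in> covector_fields A k"
  shows "theta \<eta> k u \<in> covector_fields A k"
proof -
  have "theta \<eta> k u a y \<in> covectors k" for a y
  proof -
    have "theta \<eta> k u a y =
        (\<lambda>v. \<Sum>p\<le>k. of_real (\<eta> (chart_inv a y) ^ p) * pq_projection k p (u a y) v)"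
      using theta_eq[OF assms] by blast
    then show ?thesis
      using covector_fields_covectors[OF assms]
      by (simp only:) (intro covectors_sum covectors_scale pq_projection_in_covectors)
  qed
  moreover have "theta \<eta> k u a y = 0" if "a \<notin> A \<or> y \<notin> chart_image a" for a y
  proof -
    have "u a y = 0"
      using covector_fields_outside[OF assms that] .
    then show ?thesis
      by (simp add: fun_eq_iff theta_eq[OF assms] pq_projection_def)
  qed
  ultimately show ?thesis
    by (rule covector_fieldsI)
qed

lemma chart_inv_in_domain: "y \<in> chart_image a \<Longrightarrow> chart_inv a y \<in> fst a"
  by (simp add: chart_image_def chart_inv_def inv_into_into)

text \<open>Multiplying components by powers of \<open>\<zeta>\<close> preserves their types, so by
  uniqueness they are the components of \<open>theta \<zeta> k u\<close>. The second operator then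
  produces the factors \<open>(\<eta> \<zeta>) ^ p = 1\<close>. Outside the chart images both sides
  are zero.\<close>

lemma theta_theta_inverse:
  assumes u: "u \<in> covector_fields A k"
    and \<eta>: "\<And>a x. a \<in> A \<Longrightarrow> x \<in> fst a \<Longrightarrow> \<eta> x * \<zeta> x = 1"
  shows "theta \<eta> k (theta \<zeta> k u) = u"
proof (intro ext)
  fix a y v
  show "theta \<eta> k (theta \<zeta> k u) a y v = u a y v"
  proof (cases "a \<in> A \<and> y \<in> chart_image a")
    case True
    let ?x = "chart_inv a y"
    have 1: "\<eta> ?x * \<zeta> ?x = 1"
      using True \<eta> chart_inv_in_domain by blast
    let ?f = "\<lambda>p v. of_real (\<zeta> ?x ^ p) * pq_component k (u a y) p v"
    have f: "\<forall>p\<le>k. ?f p \<in> pq_covectors p (k - p)"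
      using pq_component_in_pq_covectors[OF covector_fields_covectors[OF u]] pq_covectors_scale
      by blast
    have eq: "theta \<zeta> k u a y v = (\<Sum>p\<le>k. ?f p v)" for v
      by (simp add: theta_def)
    have "theta \<eta> k (theta \<zeta> k u) a y v = (\<Sum>p\<le>k. of_real (\<eta> ?x ^ p) * ?f p v)"
      unfolding theta_def[of \<eta>] by (intro sum.cong refl) (simp only: pq_component_eqI[OF f eq] atMost_iff)
    also have "\<dots> = (\<Sum>p\<le>k. of_real ((\<eta> ?x * \<zeta> ?x) ^ p) * pq_component k (u a y) p v)"
      by (simp add: power_mult_distrib mult.assoc)
    also have "\<dots> = u a y v"
      using sum_pq_component[OF covector_fields_covectors[OF u]] by (simp add: 1)
    finally show ?thesis .
  next
    case False
    then have "u a y = 0" "theta \<eta> k (theta \<zeta> k u) a y = 0"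
      using covector_fields_outside[OF u]
        covector_fields_outside[OF theta_in_covector_fields[OF theta_in_covector_fields[OF u]]]
      by blast+
    then show ?thesis
      by simp
  qed
qed

section \<open>Linearity of the operator \<open>theta\<close>\<close>

lemma theta_zero: "theta \<eta> k 0 = 0"
  by (simp add: fun_eq_iff theta_eq[OF zero_in_covector_fields] pq_projection_def)

lemma add_in_covector_fields:
  assumes "u \<in> covector_fields A k" "w \<in> covector_fields A k"
  shows "u + w \<in> covector_fields A k"
proof (rule covector_fieldsI)
  show "(u + w) a y \<in> covectors k" for a y
    using covectors_add[OF assms[THEN covector_fields_covectors]] by (simp add: plus_fun_def)
  show "(u + w) a y = 0" if "a \<notin> A \<or> y \<notin> chart_image a" for a y
    using assms[THEN covector_fields_outside, OF that] by simp
qed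

lemma form_scale_in_covector_fields:
  assumes "u \<in> covector_fields A k"
  shows "form_scale c u \<in> covector_fields A k"
proof (rule covector_fieldsI)
  show "form_scale c u a y \<in> covectors k" for a y
    unfolding form_scale_def by (intro covectors_scale covector_fields_covectors[OF assms])
  show "form_scale c u a y = 0" if "a \<notin> A \<or> y \<notin> chart_image a" for a y
    using covector_fields_outside[OF assms that] by (simp add: form_scale_def fun_eq_iff)
qed

lemma theta_add:
  assumes "u \<in> covector_fields A k" "w \<in> covector_fields A k"
  shows "theta \<eta> k (u + w) = theta \<eta> k u + theta \<eta> k w"
proof (intro ext)
  show "theta \<eta> k (u + w) a y v = (theta \<eta> k u + theta \<eta> k w) a y v" for a y v
    by (simp add: theta_eq[OF assms(1)] theta_eq[OF assms(2)] pq_projection_def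
        theta_eq[OF add_in_covector_fields[OF assms]] sum.distrib distrib_left)
qed

lemma theta_scale:
  assumes "u \<in> covector_fields A k"
  shows "theta \<eta> k (form_scale c u) = form_scale c (theta \<eta> k u)"
proof (intro ext)
  fix a y v
  have "pq_projection k p (form_scale c u a y) v = c * pq_projection k p (u a y) v" for p
    by (simp add: form_scale_def pq_projection_def sum_distrib_left mult_ac)
  then show "theta \<eta> k (form_scale c u) a y v = form_scale c (theta \<eta> k u) a y v"
    unfolding form_scale_def[of c "theta \<eta> k u"] theta_eq[OF assms]
      theta_eq[OF form_scale_in_covector_fields[OF assms]]
    by (simp add: sum_distrib_left mult_ac)
qed

lemma theta_diff:
  assumes "u \<in> covector_fields A k" "w \<in> covector_fields A k"
  shows "theta \<eta> k (u - w) = theta \<eta> k u - theta \<eta> k w"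
proof -
  have eq: "x - z = x + form_scale (-1) z" for x z :: "('a, 'b) form"
    by (simp add: fun_eq_iff form_scale_def)
  show ?thesis
    unfolding eq using assms
    by (simp add: theta_add form_scale_in_covector_fields theta_scale)
qed

text \<open>The point is alternation. If \<open>v a = v b\<close>, a summand that omits neither
  index still contains both equal vectors and vanishes; the summands omitting \<open>a\<close> and
  \<open>b\<close> cancel because they differ by moving one vector past the intermediate
  ones.\<close>

lemma ext_deriv_in_covectors:
  fixes f :: "complex^'n::finite \<Rightarrow> 'n covector"
  assumes cov: "\<And>z. f z \<in> covectors k" and diff: "\<And>v. (\<lambda>z. f z v) differentiable (at y)"
  shows "(\<lambda>v. \<Sum>i\<le>k. (-1) ^ i *
    frechet_derivative (\<lambda>z. f z (\<lambda>j. if j < i then v j else v (Suc j))) (at y) (v i)) \<in> covectors (Suc k)"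
    (is "(\<lambda>v. \<Sum>i\<le>k. ?t i v) \<in> _")
proof -
  define skip where "skip i v = (\<lambda>j. if j < i then v j else v (Suc j))"
    for i and v :: "nat \<Rightarrow> complex^'n"
  \<comment> \<open>The derivative with frozen arguments. Differentiation is linear, so
    \<open>D\<close> inherits multilinearity and alternation from \<open>f\<close>.\<close>
  define D where "D v = frechet_derivative (\<lambda>z. f z v) (at y)" for v
  have D: "((\<lambda>z. f z v) has_derivative D v) (at y)" for v
    using diff by (simp add: D_def frechet_derivative_works)
  have D_eqI: "D v = L" if "((\<lambda>z. f z v) has_derivative L) (at y)" for v L
    using D that has_derivative_unique by blast
  have D_cong: "D v = D w" if "\<And>i. i < k \<Longrightarrow> v i = w i" for v w
    using covectors_cong[OF cov that] by (simp add: D_def)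
  have D_linear: "linear (\<lambda>w. D (v(i := w)) x)" if "i < k" for v i x
  proof (rule linearI)
    note lin = covectors_linear[OF cov that]
    show "D (v(i := w + w')) x = D (v(i := w)) x + D (v(i := w')) x" for w w'
      using D_eqI[of "v(i := w + w')"] has_derivative_add[OF D[of "v(i := w)"] D[of "v(i := w')"]]
      by (simp add: linear_add[OF lin])
    show "D (v(i := r *\<^sub>R w)) x = r *\<^sub>R D (v(i := w)) x" for r w
      using D_eqI[of "v(i := r *\<^sub>R w)"] has_derivative_scaleR_right[OF D[of "v(i := w)"], of r]
      by (simp add: linear_scale[OF lin])
  qed
  have D_alternating: "D v = (\<lambda>x. 0)" if "i < j" "j < k" "v i = v j" for v i j
  proof (rule D_eqI)
    have "f z v = 0" for z
      using covectors_alternating[OF cov, of i j v z] that by simp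
    then show "((\<lambda>z. f z v) has_derivative (\<lambda>x. 0)) (at y)"
      by simp
  qed
  have D_transpose: "D (v \<circ> Transposition.transpose i j) x = - D v x" if "i < j" "j < k" for v i j x
  proof -
    have "f z (v \<circ> Transposition.transpose i j) = - f z v" for z
      using that by (intro covectors_transpose[OF cov]) auto
    then show ?thesis
      using D_eqI[of "v \<circ> Transposition.transpose i j"] has_derivative_minus[OF D[of v]] by simp
  qed
  \<comment> \<open>Induction on the number of indices strictly between \<open>a\<close> and
    \<open>b\<close>. If there are none, both omissions leave the same vectors. Otherwise swapping
    entries \<open>a\<close> and \<open>Suc a\<close> brings the equal entries closer: omission of
    the left one gives the same sequence as before, while omission at \<open>b\<close> picks up a
    sign.\<close>
  have D_skip: "(-1) ^ a * D (skip a v) x = - ((-1) ^ b * D (skip b v) x)"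
    if "a < b" "b \<le> k" "v a = v b" for a b v x
    using that
  proof (induction "b - Suc a" arbitrary: a v)
    case 0
    then have b: "b = Suc a"
      by simp
    have "skip a v j = skip b v j" for j
      using 0(4) by (cases "j = a") (auto simp: skip_def b less_Suc_eq)
    then have "skip a v = skip b v"
      by blast
    then show ?case
      by (simp add: b)
  next
    case (Suc m)
    let ?v = "v \<circ> Transposition.transpose a (Suc a)"
    have ab: "Suc a < b"
      using Suc.hyps(2) by simp
    have "(-1) ^ Suc a * D (skip (Suc a) ?v) x = - ((-1) ^ b * D (skip b ?v) x)"
      using Suc.prems Suc.hyps(2) ab by (intro Suc.hyps(1)) (auto simp: Transposition.transpose_def)
    moreover have "skip (Suc a) ?v = skip a v"
    proof
      show "skip (Suc a) ?v j = skip a v j" for j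
        by (cases "j = a") (auto simp: skip_def Transposition.transpose_def less_Suc_eq)
    qed
    moreover have "skip b ?v = skip b v \<circ> Transposition.transpose a (Suc a)"
      using ab by (auto simp: skip_def Transposition.transpose_def fun_eq_iff)
    moreover have "D (skip b v \<circ> Transposition.transpose a (Suc a)) x = - D (skip b v) x"
      using ab Suc.prems by (intro D_transpose) auto
    ultimately show ?case
      by (simp add: eq_neg_iff_add_eq_0 neg_eq_iff_add_eq_0)
  qed
  have "(\<lambda>v. \<Sum>i\<le>k. (-1) ^ i * D (skip i v) (v i)) \<in> covectors (Suc k)"
  proof (rule covectorsI)
    fix v w :: "nat \<Rightarrow> complex^'n"
    assume eq: "\<And>i. i < Suc k \<Longrightarrow> v i = w i"
    have "D (skip i v) = D (skip i w)" for i
      using eq by (intro D_cong) (simp add: skip_def)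
    then show "(\<Sum>i\<le>k. (-1) ^ i * D (skip i v) (v i)) = (\<Sum>i\<le>k. (-1) ^ i * D (skip i w) (w i))"
      using eq by (intro sum.cong) auto
  next
    fix v :: "nat \<Rightarrow> complex^'n" and j
    assume j: "j < Suc k"
    have "linear (\<lambda>w. (-1) ^ i * D (skip i (v(j := w))) ((v(j := w)) i))" if i: "i \<le> k" for i
    proof -
      consider "j = i" | "j < i" | "i < j"
        by linarith
      then have "linear (\<lambda>w. D (skip i (v(j := w))) ((v(j := w)) i))"
      proof cases
        case 1
        then have "skip i (v(j := w)) = skip i v" for w
          by (auto simp: skip_def)
        then show ?thesis
          using has_derivative_linear[OF D] 1 by simp
      next
        case 2
        then have "skip i (v(j := w)) = (skip i v)(j := w)" for w
          by (auto simp: skip_def)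
        then show ?thesis
          using D_linear[of j "skip i v"] 2 i by simp
      next
        case 3
        \<comment> \<open>Omitting an earlier vector shifts the varied argument down by one
          place.\<close>
        then have "skip i (v(j := w)) = (skip i v)(j - 1 := w)" for w
          by (intro ext) (auto simp: skip_def)
        then show ?thesis
          using D_linear[of "j - 1" "skip i v"] 3 j by simp
      qed
      from linear_compose[OF this linear_times] show ?thesis
        by (simp only: o_def)
    qed
    then show "linear (\<lambda>w. \<Sum>i\<le>k. (-1) ^ i * D (skip i (v(j := w))) ((v(j := w)) i))"
      by (intro linear_compose_sum) simp
  next
    fix v :: "nat \<Rightarrow> complex^'n" and a b
    assume ab: "a < b" "b < Suc k" "v a = v b"
    have "D (skip i v) = (\<lambda>x. 0)" if i: "i \<le> k" "i \<noteq> a" "i \<noteq> b" for i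
    proof (rule D_alternating)
      \<comment> \<open>The place that index \<open>j \<noteq> i\<close> occupies after the omission
        of \<open>i\<close>.\<close>
      let ?s = "\<lambda>j. if j < i then j else j - 1"
      show "?s a < ?s b" "?s b < k" "skip i v (?s a) = skip i v (?s b)"
        using i ab by (auto simp: skip_def)
    qed
    then have "(\<Sum>i\<le>k. (-1) ^ i * D (skip i v) (v i)) = (\<Sum>i\<in>{a, b}. (-1) ^ i * D (skip i v) (v i))"
      using ab by (intro sum.mono_neutral_right) auto
    also have "\<dots> = 0"
      using D_skip[of a b v "v b"] ab by simp
    finally show "(\<Sum>i\<le>k. (-1) ^ i * D (skip i v) (v i)) = 0" .
  qed
  then show ?thesis
    by (simp only: skip_def D_def)
qed

lemma ext_deriv_in_covector_fields:
  assumes u: "u \<in> smooth_forms A k"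
  shows "ext_deriv A k u \<in> covector_fields A (Suc k)"
proof -
  have outside: "ext_deriv A k u a y = 0" if "a \<notin> A \<or> y \<notin> chart_image a" for a y
    using that by (auto simp: ext_deriv_def)
  have "ext_deriv A k u a y \<in> covectors (Suc k)" for a y
  proof (cases "a \<in> A \<and> y \<in> chart_image a")
    case True
    have "(\<lambda>z. u a z v) differentiable (at y)" for v
      using smooth_forms_smooth[OF u] True smooth_on_imp_differentiable by metis
    moreover have "u a z \<in> covectors k" for z
      using u smooth_forms_covector_fields covector_fields_covectors by blast
    ultimately show ?thesis
      using True ext_deriv_in_covectors[of "u a" k y] by (simp only: ext_deriv_def if_True simp_thms)
  qed (auto simp: outside zero_in_covectors)
  then show ?thesis
    using outside by (rule covector_fieldsI)
qed

text \<open>By \<open>theta_eq\<close>, every value is a finite sum of products of powers of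
  \<open>\<eta>\<close>, constants and values of \<open>u\<close> at fixed arguments, hence smooth.
  The averaging scalars pass through the derivative of a change of charts because it is
  complex-linear.\<close>

lemma theta_smooth_forms:
  assumes X: "complex_manifold X A" and \<eta>: "smooth_function A \<eta>" and u: "u \<in> smooth_forms A k"
  shows "theta \<eta> k u \<in> smooth_forms A k"
proof -
  have u': "u \<in> covector_fields A k"
    using u smooth_forms_covector_fields by blast
  note \<theta> = theta_in_covector_fields[OF u', of \<eta>]
  have "smooth_on (chart_image a) (\<lambda>y. theta \<eta> k u a y v)" if a: "a \<in> A" for a v
  proof -
    have op: "open (chart_image a)"
      using X a by (auto simp: complex_manifold_def)
    have 1: "smooth_on (chart_image a) (\<lambda>y. complex_of_real (\<eta> (chart_inv a y)))"
      using \<eta> a by (intro smooth_on_of_real[OF op]) (simp add: smooth_function_def o_def)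
    have 2: "smooth_on (chart_image a) (\<lambda>y. u a y w)" for w
      using smooth_forms_smooth[OF u a] .
    show ?thesis
      unfolding theta_eq[OF u'] pq_projection_def of_real_power
      by (intro smooth_on_sum smooth_on_mult smooth_on_power smooth_on_const op 1 2)
  qed
  moreover have "theta \<eta> k u a y v =
      theta \<eta> k u b (transition a b y) (\<lambda>i. frechet_derivative (transition a b) (at y) (v i))"
    if ab: "a \<in> A" "b \<in> A" and y: "y \<in> snd a ` (fst a \<inter> fst b)" for a b y v
  proof -
    \<comment> \<open>Injectivity lets \<open>chart_inv\<close> recover the same point from its
      coordinates in either chart, so both expressions involve the same value of
      \<open>\<eta>\<close>.\<close>
    have inj: "inj_on (snd c) (fst c)" if "c \<in> A" for c
    proof -
      have "fst c \<subseteq> topspace X"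
        using X that by (auto simp: complex_manifold_def)
      moreover have "inj_on (snd c) (topspace (subtopology X (fst c)))"
        using X that by (intro homeomorphic_imp_injective_map) (auto simp: complex_manifold_def)
      ultimately show ?thesis
        by (simp add: Int_absorb1)
    qed
    obtain x where x: "x \<in> fst a" "x \<in> fst b" "y = snd a x"
      using y by blast
    have ia: "chart_inv a y = x"
      using x inj[OF ab(1)] by (simp add: chart_inv_def)
    then have "transition a b y = snd b x"
      by (simp add: transition_def)
    then have ib: "chart_inv b (transition a b y) = x"
      using x inj[OF ab(2)] by (simp add: chart_inv_def)
    let ?L = "frechet_derivative (transition a b) (at y)"
    have "holomorphic_map_on (transition a b) (snd a ` (fst a \<inter> fst b))"
      using X ab by (simp add: complex_manifold_def)
    then obtain L where "(transition a b has_derivative L) (at y)" and L: "\<And>c w. L (c *s w) = c *s L w"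
      using y unfolding holomorphic_map_on_def by blast
    then have "?L = L"
      using frechet_derivative_at by metis
    then have L: "?L (c *s w) = c *s ?L w" for c w
      using L by simp
    have "u a y w = u b (transition a b y) (\<lambda>i. ?L (w i))" for w
      using smooth_forms_transform[OF u ab y] .
    then show ?thesis
      by (simp add: theta_eq[OF u'] ia ib pq_projection_def L)
  qed
  ultimately show ?thesis
    using \<theta> smooth_formsI by metis
qed

text \<open>Makes \<open>theta_smooth_forms\<close> available for \<open>1 / \<eta>\<close>, which
  yields surjectivity of \<open>theta\<close> on smooth forms.\<close>

lemma smooth_function_inverse:
  assumes "complex_manifold X A" "smooth_function A \<eta>" "\<And>x. x \<in> topspace X \<Longrightarrow> \<eta> x \<noteq> 0"
  shows "smooth_function A (\<lambda>x. inverse (\<eta> x))"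
  unfolding smooth_function_def
proof
  fix a assume a: "a \<in> A"
  have "\<eta> (chart_inv a y) \<noteq> 0" if "y \<in> chart_image a" for y
    using assms(1,3) a chart_inv_in_domain[OF that] unfolding complex_manifold_def by blast
  then show "smooth_on (chart_image a) ((\<lambda>x. inverse (\<eta> x)) \<circ> chart_inv a)"
    using assms(1,2) a smooth_on_inverse[of "chart_image a" "\<eta> \<circ> chart_inv a"]
    by (simp add: complex_manifold_def smooth_function_def o_def)
qed

lemma smooth_forms_add:
  assumes X: "complex_manifold X A" and u: "u \<in> smooth_forms A k" and w: "w \<in> smooth_forms A k"
  shows "u + w \<in> smooth_forms A k"
proof (rule smooth_formsI)
  show "u + w \<in> covector_fields A k"
    using u w smooth_forms_covector_fields add_in_covector_fields by blast
  show "smooth_on (chart_image a) (\<lambda>y. (u + w) a y v)" if a: "a \<in> A" for a v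
  proof -
    have "open (chart_image a)"
      using X a by (auto simp: complex_manifold_def)
    then show ?thesis
      using smooth_forms_smooth[OF u a] smooth_forms_smooth[OF w a]
      by (simp add: smooth_on_def Ck_on_add)
  qed
  show "(u + w) a y v =
      (u + w) b (transition a b y) (\<lambda>i. frechet_derivative (transition a b) (at y) (v i))"
    if ab: "a \<in> A" "b \<in> A" "y \<in> snd a ` (fst a \<inter> fst b)" for a b y v
    using smooth_forms_transform[OF u ab, of v] smooth_forms_transform[OF w ab, of v] by simp
qed

lemma smooth_forms_scale:
  assumes X: "complex_manifold X A" and u: "u \<in> smooth_forms A k"
  shows "form_scale c u \<in> smooth_forms A k"
proof (rule smooth_formsI)
  show "form_scale c u \<in> covector_fields A k"
    using u smooth_forms_covector_fields form_scale_in_covector_fields by blast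
  show "smooth_on (chart_image a) (\<lambda>y. form_scale c u a y v)" if a: "a \<in> A" for a v
  proof -
    have "open (chart_image a)"
      using X a by (auto simp: complex_manifold_def)
    then show ?thesis
      unfolding form_scale_def by (intro smooth_on_mult smooth_on_const smooth_forms_smooth[OF u a])
  qed
  show "form_scale c u a y v =
      form_scale c u b (transition a b y) (\<lambda>i. frechet_derivative (transition a b) (at y) (v i))"
    if ab: "a \<in> A" "b \<in> A" "y \<in> snd a ` (fst a \<inter> fst b)" for a b y v
    using smooth_forms_transform[OF u ab, of v] by (simp add: form_scale_def)
qed

section \<open>Passage to cohomology\<close>

theorem proposition2p3:
  fixes X :: "'x topology"
    and A :: "('x, 'n::finite) chart set"
    and \<eta> :: "'x \<Rightarrow> real"
    and k :: nat
  assumes "complex_manifold X A"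
    and "smooth_function A \<eta>"
    and "(\<forall>x\<in>topspace X. \<eta> x > 0) \<or> (\<forall>x\<in>topspace X. \<eta> x < 0)"
    and "k \<in> {0..2 * CARD('n)}"
  shows "\<exists>T.
      (\<forall>u\<in>cocycles A (ext_deriv A) k.
         theta \<eta> k u \<in> cocycles A (D_eta A \<eta>) k \<and>
         T (coh_class A (ext_deriv A) k u) = coh_class A (D_eta A \<eta>) k (theta \<eta> k u)) \<and>
      coh_linear A (ext_deriv A) (D_eta A \<eta>) k T \<and>
      bij_betw T (cohomology A (ext_deriv A) k) (cohomology A (D_eta A \<eta>) k)"
proof -
  let ?d = "ext_deriv A" and ?D = "D_eta A \<eta>" and ?\<zeta> = "\<lambda>x. inverse (\<eta> x)"
  have nz: "\<eta> x \<noteq> 0" if "x \<in> topspace X" for x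
    using assms(3) that by force
  have nzA: "\<eta> x \<noteq> 0" if "a \<in> A" "x \<in> fst a" for a x
    using assms(1) nz that unfolding complex_manifold_def by blast
  have inverse_theta: "theta ?\<zeta> j (theta \<eta> j u) = u" "theta \<eta> j (theta ?\<zeta> j u) = u"
    if "u \<in> covector_fields A j" for u j
    using nzA by (auto intro!: theta_theta_inverse[OF that])
  then have inj: "inj_on (theta \<eta> j) (covector_fields A j)" for j
    by (intro inj_on_inverseI)
  have \<theta>: "theta \<eta> j u \<in> smooth_forms A j" if "u \<in> smooth_forms A j" for u j
    using theta_smooth_forms[OF assms(1,2) that] .
  have surj: "theta \<eta> j ` smooth_forms A j = smooth_forms A j" for j
  proof
    show "smooth_forms A j \<subseteq> theta \<eta> j ` smooth_forms A j"
    proof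
      fix u assume u: "u \<in> smooth_forms A j"
      then have "theta ?\<zeta> j u \<in> smooth_forms A j"
        using theta_smooth_forms[OF assms(1) smooth_function_inverse[OF assms(1,2) nz]] by blast
      then show "u \<in> theta \<eta> j ` smooth_forms A j"
        using inverse_theta(2) u smooth_forms_covector_fields by (metis image_eqI subsetD)
    qed
  qed (use \<theta> in blast)
  have inj_smooth: "inj_on (theta \<eta> j) (smooth_forms A j)" for j
    by (rule inj_on_subset[OF inj smooth_forms_covector_fields])
  \<comment> \<open>Since \<open>theta\<close> is injective on smooth forms, the
    \<open>inv_into\<close> in \<open>D_eta\<close> is a true inverse here, and \<open>theta\<close>
    intertwines the two differentials.\<close>
  have D_theta: "?D j (theta \<eta> j u) = theta \<eta> (Suc j) (?d j u)" if "u \<in> smooth_forms A j" for j u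
    using that by (simp add: D_eta_def inv_into_f_f[OF inj_smooth])
  have cocycle_iff: "theta \<eta> k u \<in> cocycles A ?D k \<longleftrightarrow> u \<in> cocycles A ?d k"
    if "u \<in> smooth_forms A k" for u
  proof -
    have "theta \<eta> (Suc k) (?d k u) = 0 \<longleftrightarrow> ?d k u = 0"
      using inj_on_eq_iff[OF inj ext_deriv_in_covector_fields[OF that] zero_in_covector_fields]
      by (simp add: theta_zero)
    then show ?thesis
      using that \<theta> by (simp add: cocycles_def D_theta)
  qed
  have cocycles_image: "cocycles A ?D k = theta \<eta> k ` cocycles A ?d k"
  proof
    show "theta \<eta> k ` cocycles A ?d k \<subseteq> cocycles A ?D k"
      using cocycle_iff by (auto simp: cocycles_def)
    show "cocycles A ?D k \<subseteq> theta \<eta> k ` cocycles A ?d k"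
    proof
      fix z assume z: "z \<in> cocycles A ?D k"
      then have "z \<in> theta \<eta> k ` smooth_forms A k"
        by (simp add: cocycles_def surj)
      then show "z \<in> theta \<eta> k ` cocycles A ?d k"
        using z cocycle_iff by blast
    qed
  qed
  \<comment> \<open>In degree \<open>0\<close> both sides are \<open>{0}\<close>. In positive
    degree, \<open>surj\<close> presents every smooth form as an image under \<open>theta\<close>,
    so that \<open>D_theta\<close> applies.\<close>
  have coboundaries_image: "coboundaries A ?D k = theta \<eta> k ` coboundaries A ?d k"
  proof (cases k)
    case (Suc j)
    have "?D j ` smooth_forms A j = ?D j ` theta \<eta> j ` smooth_forms A j"
      by (simp only: surj)
    also have "\<dots> = theta \<eta> (Suc j) ` ?d j ` smooth_forms A j"
      by (simp only: image_image) (intro image_cong refl D_theta)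
    finally show ?thesis
      by (simp add: coboundaries_def Suc)
  qed (simp add: coboundaries_def theta_zero)
  \<comment> \<open>Places the coboundaries where \<open>theta\<close> is injective, so that
    membership in their image can be pulled back.\<close>
  have coboundaries_fields: "coboundaries A ?d k \<subseteq> covector_fields A k"
    using ext_deriv_in_covector_fields zero_in_covector_fields
    by (auto simp: coboundaries_def split: nat.split)
  have rel_iff: "(theta \<eta> k u, theta \<eta> k w) \<in> coh_rel A ?D k \<longleftrightarrow> (u, w) \<in> coh_rel A ?d k"
    if u: "u \<in> smooth_forms A k" and w: "w \<in> smooth_forms A k" for u w
  proof -
    have uw: "u \<in> covector_fields A k" "w \<in> covector_fields A k"
      using u w smooth_forms_covector_fields by blast+
    have "u - w = u + form_scale (-1) w"
      by (simp add: fun_eq_iff form_scale_def)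
    then have "u - w \<in> smooth_forms A k"
      using smooth_forms_add smooth_forms_scale assms(1) u w by metis
    then have "u - w \<in> covector_fields A k"
      using smooth_forms_covector_fields by blast
    then have "theta \<eta> k (u - w) \<in> theta \<eta> k ` coboundaries A ?d k \<longleftrightarrow> u - w \<in> coboundaries A ?d k"
      using inj_on_image_mem_iff[OF inj _ coboundaries_fields] by blast
    then show ?thesis
      using u w by (simp add: coh_rel_def cocycle_iff coboundaries_image theta_diff[OF uw])
  qed
  \<comment> \<open>Stated for all smooth \<open>u\<close>: if \<open>u\<close> is not closed, both
    classes are empty. Sums and multiples of representatives can then be treated without checking
    that they are cocycles.\<close>
  have class_image: "theta \<eta> k ` coh_class A ?d k u = coh_class A ?D k (theta \<eta> k u)"
    if u: "u \<in> smooth_forms A k" for u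
  proof
    show "theta \<eta> k ` coh_class A ?d k u \<subseteq> coh_class A ?D k (theta \<eta> k u)"
      using rel_iff[OF u] by (auto simp: coh_class_def coh_rel_def cocycles_def)
    show "coh_class A ?D k (theta \<eta> k u) \<subseteq> theta \<eta> k ` coh_class A ?d k u"
    proof
      fix z assume "z \<in> coh_class A ?D k (theta \<eta> k u)"
      then have z: "(theta \<eta> k u, z) \<in> coh_rel A ?D k"
        by (simp add: coh_class_def)
      then have "z \<in> smooth_forms A k"
        by (simp add: coh_rel_def cocycles_def)
      then obtain w where w: "w \<in> smooth_forms A k" "z = theta \<eta> k w"
        using surj by blast
      then show "z \<in> theta \<eta> k ` coh_class A ?d k u"
        using z rel_iff[OF u w(1)] by (auto simp: coh_class_def)
    qed
  qed
  have cohomology_eq: "cohomology A E k = coh_class A E k ` cocycles A E k" for E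
    by (auto simp: cohomology_def quotient_def coh_class_def)
  have class_smooth: "\<alpha> \<subseteq> smooth_forms A k" if "\<alpha> \<in> cohomology A ?d k" for \<alpha>
    using that by (auto simp: cohomology_eq coh_class_def coh_rel_def cocycles_def)
  \<comment> \<open>Classes are sets of forms, so direct image serves as the induced map; no
    representative is chosen, and \<open>class_image\<close> shows that classes go to
    classes.\<close>
  let ?T = "\<lambda>\<alpha>. theta \<eta> k ` \<alpha>"
  have T_class: "?T (coh_class A ?d k u) = coh_class A ?D k (theta \<eta> k u)" if "u \<in> cocycles A ?d k" for u
    using that class_image by (simp add: cocycles_def)
  have "?T (coh_add A ?d k \<alpha> \<beta>) = coh_add A ?D k (?T \<alpha>) (?T \<beta>)"
    if \<alpha>: "\<alpha> \<in> cohomology A ?d k" and \<beta>: "\<beta> \<in> cohomology A ?d k" for \<alpha> \<beta>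
  proof -
    have "?T (coh_class A ?d k (u + w)) = coh_class A ?D k (theta \<eta> k u + theta \<eta> k w)"
      if "u \<in> \<alpha>" "w \<in> \<beta>" for u w
    proof -
      have uw: "u \<in> smooth_forms A k" "w \<in> smooth_forms A k"
        using that class_smooth \<alpha> \<beta> by blast+
      then have "theta \<eta> k (u + w) = theta \<eta> k u + theta \<eta> k w"
        using smooth_forms_covector_fields by (intro theta_add) blast+
      then show ?thesis
        using class_image[OF smooth_forms_add[OF assms(1) uw]] by simp
    qed
    then show ?thesis
      by (simp add: coh_add_def image_UN)
  qed
  moreover have "?T (coh_scale A ?d k c \<alpha>) = coh_scale A ?D k c (?T \<alpha>)"
    if \<alpha>: "\<alpha> \<in> cohomology A ?d k" for c \<alpha>
  proof -
    have "?T (coh_class A ?d k (form_scale c u)) = coh_class A ?D k (form_scale c (theta \<eta> k u))"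
      if "u \<in> \<alpha>" for u
    proof -
      have u: "u \<in> smooth_forms A k"
        using that class_smooth \<alpha> by blast
      then show ?thesis
        using class_image[OF smooth_forms_scale[OF assms(1) u], of c]
        by (simp only: theta_scale[OF subsetD[OF smooth_forms_covector_fields u]])
    qed
    then show ?thesis
      by (simp add: coh_scale_def image_UN)
  qed
  ultimately have linear: "coh_linear A ?d ?D k ?T"
    by (simp add: coh_linear_def)
  have bij: "bij_betw ?T (cohomology A ?d k) (cohomology A ?D k)"
  proof (rule bij_betw_imageI)
    \<comment> \<open>Classes are subsets of the smooth forms, on which \<open>theta\<close> is
      injective, so the direct image determines the class.\<close>
    show "inj_on ?T (cohomology A ?d k)"
      using inj_on_image_eq_iff[OF inj_smooth] class_smooth by (auto intro!: inj_onI)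
    show "?T ` cohomology A ?d k = cohomology A ?D k"
      by (simp add: cohomology_eq cocycles_image image_image T_class cong: image_cong)
  qed
  have "theta \<eta> k u \<in> cocycles A ?D k" if "u \<in> cocycles A ?d k" for u
    using that cocycles_image by blast
  then show ?thesis
    by (intro exI[of _ ?T] conjI ballI T_class linear bij)
qed

end
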